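(* Take $(s,x)\in I\times U$. Write $t=t(s,x)$, and let $\frac{\partial}{\partial s}\delta(s,t(s,x))$, $\frac{\partial^2}{\partial s^2}\delta(s,t(s,x))$ denote derivatives in $s$ with $x$ fixed. (1) $(s,x)$ is an $A_1$ point for $G$ if and only if $x=X(s,t)$ and $\delta(s,t(s,x))\neq0$. (2) $(s,x)$ is an $A_2$ point for $G$ if and only if $x=X(s,t)$, $\delta(s,t(s,x))=0$ and $\frac{\partial}{\partial s}\delta(s,t(s,x))\neq0$, this last condition being equivalent (given the preceding ones) to $\alpha(s)\neq\tau_s(s)$. Moreover, the unfolding $G$ is versal at this point. (3) $(s,x)$ is an $A_3$ point for $G$ if and only if $x=X(s,t)$, $\delta(s,t(s,x))=0$, $\frac{\partial}{\partial s}\delta(s,t(s,x))=0$ and $\frac{\partial^2}{\partial s^2}\delta(s,t(s,x))\neq0$, the last two conditions being equivalent (given the preceding ones) to $\alpha(s)=\tau_s(s)$ and $\alpha'(s)\neq\tau_{ss}(s)$. Moreover, the unfolding $G$ is versal at this point.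
   Context: For $u,v\in\mathbb{R}^2$, $[u,v]$ is the determinant of the matrix with columns $u,v$. Let $\Omega\subset\mathbb{R}^2$ be a simply connected domain with coordinates $(s,t)$ and let $A,B,C,D:\Omega\to\mathbb{R}$ be such that $A-iD$ and $B+iC$ are holomorphic functions of $s+it$, i.e. $A_s=-D_t$, $A_t=D_s$, $B_s=C_t$, $B_t=-C_s$. Put $X(s,t)=(A(s,t),B(s,t))$ (the planar map, written $x(s,t)$ in the source), $c(s,t)=(-D(s,t),C(s,t))$, $\delta(s,t)=[X_s,X_t]$. Let $g:\Omega\to\mathbb{R}$ satisfy $g_s=[X_s,c]$, $g_t=[X_t,c]$ (unique up to an additive constant). Let $S=\{\delta=0\}\subset\Omega$ be the singular set, and assume $(\delta_s,\delta_t)\neq(0,0)$ on $S$. Standing assumptions: fix $(s_0,t_0)\in S$ with $\delta_t(s_0,t_0)\neq0$, $X_t(s_0,t_0)\ne 0$ and $[X_t(s_0,t_0),c(s_0,t_0)]\neq0$; put $x_0=X(s_0,t_0)$. Then there are open neighborhoods $I$ of $s_0$, $J$ of $t_0$, $U\subset\mathbb{R}^2$ of $x_0$ and a smooth function $t:I\times U\to J$ such that, for $(s,t,x)\in I\times J\times U$, $[x-X(s,t),c(s,t)]=0$ if and only if $t=t(s,x)$. The neighborhoods $I,J,U$ are taken sufficiently small (they may be chosen arbitrarily small); in particular $\delta_t\ne0$ and $X_t\neq0$ on $I\times J$, and $S\cap(I\times J)$ is the graph $\{(s,\tau(s)):s\in I\}$ of a smooth function $\tau$. The function $\alpha$ on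 $I$ is defined by $X_s(s,\tau(s))+\alpha(s)X_t(s,\tau(s))=0$. The generating family is $G:I\times U\to\mathbb{R}$, $G(s,x)=g(s,t(s,x))$, viewed as a family of functions of $s$ with parameter $x=(x_1,x_2)\in U$. A point $(s,x)$ is an $A_k$ point for $G$ if $\partial_s^jG(s,x)=0$ for $1\le j\le k$ and $\partial_s^{k+1}G(s,x)\neq0$. Versality of $G$ at an $A_k$ point is meant for unfoldings up to addition of functions of the parameters (as in Bruce–Giblin, "Curves and Singularities"): the vectors $(\partial_sG_{x_i},\dots,\partial_s^{k-1}G_{x_i})$, $i=1,2$, evaluated at the point, span $\mathbb{R}^{k-1}$; that is, $\partial_s(G_{x_1},G_{x_2})\neq(0,0)$ for $k=2$, and $[\partial_s(G_{x_1},G_{x_2}),\partial_s^2(G_{x_1},G_{x_2})]\neq0$ for $k=3$. *)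

theory Defs
  imports "HOL-Analysis.Analysis"
begin

definition bracket :: "real^2 \<Rightarrow> real^2 \<Rightarrow> real" where
  "bracket u v = det (transpose (vector [u, v] :: real^2^2))"

lemma bracket_components: "bracket u v = u$1 * v$2 - u$2 * v$1"
  by (simp add: bracket_def det_2 transpose_def algebra_simps)

text \<open>Partial derivatives of functions of \<open>(s, t)\<close>, with values in the reals or the plane.\<close>

definition ds :: "(real \<Rightarrow> real \<Rightarrow> 'a::real_normed_vector) \<Rightarrow> real \<Rightarrow> real \<Rightarrow> 'a" where
  "ds f s t = vector_derivative (\<lambda>\<sigma>. f \<sigma> t) (at s)"

definition dt :: "(real \<Rightarrow> real \<Rightarrow> 'a::real_normed_vector) \<Rightarrow> real \<Rightarrow> real \<Rightarrow> 'a" where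
  "dt f s t = vector_derivative (\<lambda>r. f s r) (at t)"

text \<open>\<open>C\<^sup>k\<close> and smooth maps, meant for open domains: the derivative in every fixed direction
  is again \<open>C\<^sup>k\<close>, which in finite dimension is the usual notion.\<close>

primrec Ck_on :: "nat \<Rightarrow> ('a::real_normed_vector \<Rightarrow> 'b::real_normed_vector) \<Rightarrow> 'a set \<Rightarrow> bool" where
  "Ck_on 0 f M \<longleftrightarrow> continuous_on M f"
| "Ck_on (Suc k) f M \<longleftrightarrow> (\<forall>p\<in>M. f differentiable (at p)) \<and>
     (\<forall>v. Ck_on k (\<lambda>p. frechet_derivative f (at p) v) M)"

definition smooth_on :: "('a::real_normed_vector \<Rightarrow> 'b::real_normed_vector) \<Rightarrow> 'a set \<Rightarrow> bool" where
  "smooth_on f M \<longleftrightarrow> (\<forall>k. Ck_on k f M)"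

definition is_A_point :: "nat \<Rightarrow> (real \<Rightarrow> real^2 \<Rightarrow> real) \<Rightarrow> real \<Rightarrow> real^2 \<Rightarrow> bool" where
  "is_A_point k G s x \<longleftrightarrow>
     (\<forall>j\<in>{1..k}. (deriv ^^ j) (\<lambda>\<sigma>. G \<sigma> x) s = 0) \<and> (deriv ^^ (k + 1)) (\<lambda>\<sigma>. G \<sigma> x) s \<noteq> 0"

definition param_deriv :: "(real \<Rightarrow> real^2 \<Rightarrow> real) \<Rightarrow> 2 \<Rightarrow> real \<Rightarrow> real^2 \<Rightarrow> real" where
  "param_deriv G i s x = deriv (\<lambda>h. G s (x + h *\<^sub>R axis i 1)) 0"

text \<open>Versality, up to addition of functions of the parameters, at an \<open>A\<^sub>k\<close> point: the two vectors
  of the derivatives of orders \<open>1, \<dots>, k - 1\<close> in \<open>s\<close> of the \<open>x\<^sub>i\<close>-partials of \<open>G\<close> span the space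
  of dimension \<open>k - 1\<close>. A vector of that space is a function \<open>w\<close> on the index set \<open>{1..<k}\<close>.\<close>

definition versal_at :: "nat \<Rightarrow> (real \<Rightarrow> real^2 \<Rightarrow> real) \<Rightarrow> real \<Rightarrow> real^2 \<Rightarrow> bool" where
  "versal_at k G s x \<longleftrightarrow>
     (\<forall>w :: nat \<Rightarrow> real. \<exists>a :: real^2. \<forall>j\<in>{1..<k}.
        w j = (\<Sum>i\<in>UNIV. a $ i * (deriv ^^ j) (\<lambda>\<sigma>. param_deriv G i \<sigma> x) s))"

end

theory Submission
  imports Defs "HOL-Complex_Analysis.Cauchy_Integral_Formula"
begin

text \<open>Write \<open>F = A - iD\<close> and \<open>H = B + iC\<close>. Then \<open>X\<close> and \<open>c\<close> are the real and the imaginary part of the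
holomorphic curve \<open>(F, H)\<close>, so \<open>X\<^sub>s\<close> is the real part of \<open>(F', H')\<close>, \<open>X\<^sub>t\<close> is minus its imaginary
part, and the Cauchy-Riemann equations read \<open>c\<^sub>t = X\<^sub>s\<close>, \<open>c\<^sub>s = - X\<^sub>t\<close>.

Fix \<open>x\<close>, let \<open>t\<close> stand for the function \<open>s \<mapsto> t(s, x)\<close>, and put \<open>y = x - X(s, t)\<close>. The equation
\<open>[y, c] = 0\<close> says that \<open>y\<close> is a multiple of \<open>c\<close>; since \<open>g\<^sub>t = [X\<^sub>t, c]\<close> does not vanish, that multiple
is measured by \<open>\<mu> = [X\<^sub>t, y]\<close>, through \<open>g\<^sub>t y = \<mu> c\<close>. Differentiating \<open>[y, c] = 0\<close> yields \<open>t'\<close> and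
\<open>G\<^sub>s = g\<^sub>s + t' g\<^sub>t = (K / g\<^sub>t) \<mu>\<close>, where \<open>K\<close> is the bracket of \<open>c\<close> with its derivative along the
curve \<open>(s, t(s))\<close> (\<open>slope_factor\<close>). Differentiating \<open>\<mu>\<close> yields \<open>\<mu>' = \<delta> + n \<mu>\<close> with a smooth \<open>n\<close>
(\<open>m_ode\<close>), because the bracket of \<open>X\<^sub>t\<close> with the velocity \<open>- (X\<^sub>s + t' X\<^sub>t)\<close> of \<open>y\<close> is \<open>\<delta>\<close> whatever
\<open>t'\<close> is. As \<open>K \<noteq> 0\<close>, the order of vanishing of \<open>G\<^sub>s\<close> equals that of \<open>\<mu>\<close>; and by the differential
equation \<open>\<mu>\<close> vanishes to order \<open>j + 1\<close> exactly when \<open>\<mu> = 0\<close>, that is \<open>x = X(s, t)\<close>, and \<open>\<delta>\<close>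
vanishes to order \<open>j\<close> along the curve. This is the description of the \<open>A\<^sub>k\<close> points for all \<open>k\<close> at
once (\<open>A_point_iff\<close>).

Where \<open>x = X(s, t)\<close> and \<open>\<delta> = 0\<close>, the velocity \<open>t'\<close> is the null slope \<open>\<alpha>\<close>. The derivative of \<open>\<delta>\<close>
along a curve through this point with slope \<open>\<alpha>\<close>, multiplied by \<open>g\<^sub>t\<close>, is the function
\<open>w = g\<^sub>t \<delta>\<^sub>s - g\<^sub>s \<delta>\<^sub>t\<close>, which on the singular curve is \<open>g\<^sub>t (\<alpha> - \<tau>') \<delta>\<^sub>t\<close>. If moreover \<open>\<alpha> = \<tau>'\<close>, the
graphs of \<open>t\<close> and \<open>\<tau>\<close> are tangent, so \<open>w\<close> has the same derivative along both; this compares the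
second derivative of \<open>\<delta>\<close> with \<open>\<alpha>' - \<tau>''\<close> without any second-order chain rule
(\<open>jac_deriv2_eq\<close>).

For versality, \<open>G\<close> has the partial derivative \<open>[e\<^sub>i, c] (1 + r \<mu>)\<close> in \<open>x\<^sub>i\<close> with a smooth \<open>r\<close>, so at
an \<open>A\<^sub>k\<close> point its \<open>s\<close>-derivatives up to order \<open>k - 1\<close> are those of \<open>[e\<^sub>i, c]\<close>
(\<open>unfolding_direction_jet\<close>). It remains to see that \<open>c' \<noteq> 0\<close>, which follows from \<open>K \<noteq> 0\<close>, and at
an \<open>A\<^sub>3\<close> point that \<open>[c', c''] \<noteq> 0\<close>, because otherwise \<open>\<delta>\<^sub>t = 0\<close> (\<open>c_curvature_nonzero\<close>).

Three inequalities are used: \<open>g\<^sub>t \<noteq> 0\<close>, the solvability of \<open>[y, c] = 0\<close> for \<open>t\<close>, and \<open>K \<noteq> 0\<close>. At the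
base point \<open>y = 0\<close>, and they reduce to \<open>g\<^sub>t \<noteq> 0\<close> and \<open>g\<^sub>t\<^sup>2 + g\<^sub>s\<^sup>2 \<noteq> 0\<close>; they are open conditions on
\<open>(s, t, x)\<close>, and this is what determines how small the neighbourhoods have to be.\<close>

section \<open>Smooth functions of one variable and their order of vanishing\<close>

primrec times_diff :: "nat \<Rightarrow> (real \<Rightarrow> real) \<Rightarrow> real set \<Rightarrow> bool" where
  "times_diff 0 f I \<longleftrightarrow> True"
| "times_diff (Suc k) f I \<longleftrightarrow> (\<forall>s\<in>I. f field_differentiable (at s)) \<and> times_diff k (deriv f) I"

lemma iterated_deriv_cong:
  assumes "open I" and "\<And>s. s \<in> I \<Longrightarrow> f s = g s" and "s \<in> I"
  shows "(deriv ^^ j) f s = (deriv ^^ j) g s"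
  using assms(2,3)
proof (induction j arbitrary: s)
  case (Suc j)
  have "\<forall>\<^sub>F r in nhds s. (deriv ^^ j) f r = (deriv ^^ j) g r"
    using Suc \<open>open I\<close> by (auto simp: eventually_nhds)
  then show ?case by (simp add: deriv_cong_ev)
qed simp

lemma times_diff_cong:
  assumes "open I" and "\<And>s. s \<in> I \<Longrightarrow> f s = g s" and "times_diff k f I"
  shows "times_diff k g I"
  using assms(2,3)
proof (induction k arbitrary: f g)
  case (Suc k)
  have ev: "\<forall>\<^sub>F r in nhds s. f r = g r" if "s \<in> I" for s
    using Suc.prems that \<open>open I\<close> by (auto simp: eventually_nhds)
  have "g field_differentiable (at s)" if "s \<in> I" for s
    using Suc.prems that has_field_derivative_transform_within_open[OF _ \<open>open I\<close> that, of f _ g]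
    unfolding field_differentiable_def times_diff.simps by blast
  moreover have "times_diff k (deriv g) I"
    using Suc.IH[of "deriv f" "deriv g"] Suc.prems ev by (auto intro: deriv_cong_ev)
  ultimately show ?case by simp
qed simp

lemma times_diff_SucI:
  assumes "open I" and "\<And>s. s \<in> I \<Longrightarrow> (f has_real_derivative f' s) (at s)" and "times_diff k f' I"
  shows "times_diff (Suc k) f I"
proof -
  have "deriv f s = f' s" if "s \<in> I" for s using assms(2) that by (simp add: DERIV_imp_deriv)
  then have "times_diff k (deriv f) I" using times_diff_cong[OF assms(1) _ assms(3)] by simp
  then show ?thesis using assms(2) by (auto simp: field_differentiable_def)
qed

lemma times_diff_SucD: "times_diff (Suc k) f I \<Longrightarrow> times_diff k f I"
  by (induction k arbitrary: f) auto

lemma times_diff_has_derivative: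
  "times_diff (Suc k) f I \<Longrightarrow> s \<in> I \<Longrightarrow> (f has_real_derivative deriv f s) (at s)"
  by (simp add: DERIV_deriv_iff_field_differentiable)

lemma times_diff_const: "times_diff k (\<lambda>s. a) I"
  by (induction k arbitrary: a) auto

lemma times_diff_add:
  "open I \<Longrightarrow> times_diff k f I \<Longrightarrow> times_diff k g I \<Longrightarrow> times_diff k (\<lambda>s. f s + g s) I"
proof (induction k arbitrary: f g)
  case (Suc k)
  show ?case
    by (rule times_diff_SucI[where f' = "\<lambda>s. deriv f s + deriv g s"])
      (use Suc in \<open>auto intro!: derivative_eq_intros times_diff_has_derivative\<close>)
qed simp

lemma times_diff_mult:
  "open I \<Longrightarrow> times_diff k f I \<Longrightarrow> times_diff k g I \<Longrightarrow> times_diff k (\<lambda>s. f s * g s) I"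
proof (induction k arbitrary: f g)
  case (Suc k)
  have "times_diff k (\<lambda>s. deriv f s * g s + f s * deriv g s) I"
    using Suc times_diff_SucD[OF Suc.prems(2)] times_diff_SucD[OF Suc.prems(3)]
    by (intro times_diff_add Suc.IH) auto
  then show ?case
    using Suc.prems
    by (intro times_diff_SucI[where f' = "\<lambda>s. deriv f s * g s + f s * deriv g s"])
      (auto intro!: derivative_eq_intros times_diff_has_derivative)
qed simp

lemma times_diff_minus: "open I \<Longrightarrow> times_diff k f I \<Longrightarrow> times_diff k (\<lambda>s. - f s) I"
  using times_diff_mult[OF _ times_diff_const[of k "-1"], of I f] by simp

lemma times_diff_diff:
  "open I \<Longrightarrow> times_diff k f I \<Longrightarrow> times_diff k g I \<Longrightarrow> times_diff k (\<lambda>s. f s - g s) I"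
  using times_diff_add[OF _ _ times_diff_minus, of I k f g] by simp

text \<open>The derivative of \<open>1 / f\<close> is again a polynomial in \<open>f'\<close> and \<open>1 / f\<close>, so induction applies.\<close>

lemma times_diff_inverse:
  "open I \<Longrightarrow> (\<And>s. s \<in> I \<Longrightarrow> f s \<noteq> 0) \<Longrightarrow> times_diff k f I \<Longrightarrow> times_diff k (\<lambda>s. inverse (f s)) I"
proof (induction k)
  case (Suc k)
  have "times_diff k (\<lambda>s. - (inverse (f s) * deriv f s * inverse (f s))) I"
    using Suc times_diff_SucD[OF Suc.prems(3)]
    by (intro times_diff_minus times_diff_mult Suc.IH) auto
  then show ?case
    using Suc.prems
    by (intro times_diff_SucI[where f' = "\<lambda>s. - (inverse (f s) * deriv f s * inverse (f s))"])
      (auto intro!: DERIV_inverse' times_diff_has_derivative)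
qed simp

lemma times_diff_divide:
  assumes "open I" "\<And>s. s \<in> I \<Longrightarrow> g s \<noteq> 0" "times_diff k f I" "times_diff k g I"
  shows "times_diff k (\<lambda>s. f s / g s) I"
  using times_diff_mult[OF assms(1,3) times_diff_inverse[OF assms(1,2,4)]] by (simp add: divide_inverse)

lemmas times_diff_intros =
  times_diff_const times_diff_add times_diff_mult times_diff_minus times_diff_diff
  times_diff_divide

text \<open>A derivative known on the open set \<open>I\<close> may be substituted under further derivatives; this is how
  an explicit formula for \<open>f'\<close> enters the higher derivatives of \<open>f\<close>.\<close>

lemma iterated_deriv_Suc:
  assumes "open I" and "\<And>s. s \<in> I \<Longrightarrow> (f has_real_derivative f' s) (at s)" and "s \<in> I"
  shows "(deriv ^^ Suc j) f s = (deriv ^^ j) f' s"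
proof -
  have "deriv f r = f' r" if "r \<in> I" for r using assms(2) that by (simp add: DERIV_imp_deriv)
  then show ?thesis
    using iterated_deriv_cong[OF assms(1) _ assms(3), of "deriv f" f' j]
    by (simp add: funpow_Suc_right del: funpow.simps(2))
qed

lemma iterated_deriv_add:
  "open I \<Longrightarrow> times_diff j f I \<Longrightarrow> times_diff j g I \<Longrightarrow> s \<in> I \<Longrightarrow>
    (deriv ^^ j) (\<lambda>s. f s + g s) s = (deriv ^^ j) f s + (deriv ^^ j) g s"
proof (induction j arbitrary: f g)
  case (Suc j)
  have "(deriv ^^ Suc j) (\<lambda>s. f s + g s) s = (deriv ^^ j) (\<lambda>s. deriv f s + deriv g s) s"
    by (rule iterated_deriv_Suc[OF Suc.prems(1) _ Suc.prems(4)])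
      (use Suc.prems in \<open>auto intro!: derivative_eq_intros times_diff_has_derivative\<close>)
  then show ?case using Suc by (simp add: funpow_Suc_right del: funpow.simps(2))
qed simp

lemma iterated_deriv_minus:
  assumes "open I" and "times_diff j f I" and "s \<in> I"
  shows "(deriv ^^ j) (\<lambda>s. - f s) s = - (deriv ^^ j) f s"
proof -
  have zero: "(deriv ^^ j) (\<lambda>s. 0 :: real) = (\<lambda>s. 0)" by (induction j) auto
  show ?thesis
    using iterated_deriv_add[OF assms(1,2) times_diff_minus[OF assms(1,2)] assms(3)] by (simp add: zero)
qed

text \<open>Vanishing to order \<open>j\<close>: the zeroth to the \<open>(j - 1)\<close>-st derivative are zero, so that \<open>flat 0\<close> is no
  condition and \<open>flat 1\<close> says that \<open>s\<close> is a zero.\<close>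

definition flat :: "nat \<Rightarrow> (real \<Rightarrow> real) \<Rightarrow> real \<Rightarrow> bool" where
  "flat j f s \<longleftrightarrow> (\<forall>i<j. (deriv ^^ i) f s = 0)"

lemma flat_0 [simp]: "flat 0 f s" by (simp add: flat_def)

lemma flat_Suc: "flat (Suc j) f s \<longleftrightarrow> f s = 0 \<and> flat j (deriv f) s"
  by (auto simp: flat_def less_Suc_eq_0_disj funpow_Suc_right simp del: funpow.simps(2))

lemma flat_Suc': "flat (Suc j) f s \<longleftrightarrow> flat j f s \<and> (deriv ^^ j) f s = 0"
  by (auto simp: flat_def less_Suc_eq)

lemma flat_cong:
  assumes "open I" and "\<And>s. s \<in> I \<Longrightarrow> f s = g s" and "s \<in> I"
  shows "flat j f s \<longleftrightarrow> flat j g s"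
  unfolding flat_def using iterated_deriv_cong[OF assms] by simp

lemma flat_Suc_has_derivative:
  assumes "open I" and "\<And>s. s \<in> I \<Longrightarrow> (f has_real_derivative f' s) (at s)" and "s \<in> I"
  shows "flat (Suc j) f s \<longleftrightarrow> f s = 0 \<and> flat j f' s"
  using flat_cong[OF assms(1) _ assms(3), of "deriv f" f' j] assms(2)
  by (simp add: flat_Suc DERIV_imp_deriv)

lemma flat_add:
  assumes "open I" "times_diff j f I" "times_diff j g I" "s \<in> I" "flat j f s" "flat j g s"
  shows "flat j (\<lambda>s. f s + g s) s"
proof -
  have td: "times_diff i h I" if "i \<le> j" "times_diff j h I" for i h
    using that by (induction rule: inc_induct) (auto dest: times_diff_SucD simp del: times_diff.simps(2))
  show ?thesis using assms unfolding flat_def by (auto simp: iterated_deriv_add[OF assms(1)] td)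
qed

text \<open>In \<open>(k f)' = k' f + k f'\<close> both terms have a factor that vanishes to order \<open>j\<close> when \<open>f\<close> vanishes to
  order \<open>j + 1\<close>.\<close>

lemma flat_mult:
  "open I \<Longrightarrow> times_diff j k I \<Longrightarrow> times_diff j f I \<Longrightarrow> s \<in> I \<Longrightarrow> flat j f s \<Longrightarrow> flat j (\<lambda>s. k s * f s) s"
proof (induction j arbitrary: k f)
  case (Suc j)
  note low = times_diff_SucD[OF Suc.prems(2)] times_diff_SucD[OF Suc.prems(3)]
  have f0: "f s = 0" "flat j f s" "flat j (deriv f) s"
    using Suc.prems(5) flat_Suc[of j f s] flat_Suc'[of j f s] by auto
  have "flat j (\<lambda>s. deriv k s * f s + k s * deriv f s) s"
    using Suc.prems low f0
    by (intro flat_add[where I = I] Suc.IH times_diff_mult) auto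
  moreover have "((\<lambda>s. k s * f s) has_real_derivative deriv k r * f r + k r * deriv f r) (at r)"
    if "r \<in> I" for r
    using that Suc.prems by (auto intro!: derivative_eq_intros times_diff_has_derivative)
  ultimately show ?case
    using flat_Suc_has_derivative[OF Suc.prems(1), of "\<lambda>s. k s * f s"
        "\<lambda>s. deriv k s * f s + k s * deriv f s"] Suc.prems(4) f0 by simp
qed simp

lemma flat_mult_nonzero_iff:
  assumes "open I" "times_diff j k I" "times_diff j f I" "s \<in> I" and nz: "\<And>s. s \<in> I \<Longrightarrow> k s \<noteq> 0"
  shows "flat j (\<lambda>s. k s * f s) s \<longleftrightarrow> flat j f s"
proof
  assume "flat j (\<lambda>s. k s * f s) s"
  then have "flat j (\<lambda>s. inverse (k s) * (k s * f s)) s"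
    using assms
    by (intro flat_mult[OF assms(1) times_diff_inverse times_diff_mult]) auto
  also have "flat j (\<lambda>s. inverse (k s) * (k s * f s)) s \<longleftrightarrow> flat j f s"
    by (rule flat_cong[OF assms(1) _ assms(4)]) (simp add: nz)
  finally show "flat j f s" .
qed (use assms flat_mult in blast)

text \<open>Solutions of a linear equation vanish to one order more than the inhomogeneity: once \<open>\<mu>\<close> vanishes
  to order \<open>j\<close>, the term \<open>n \<mu>\<close> does not affect the derivatives of order below \<open>j\<close> in \<open>\<mu>' = \<delta> + n \<mu>\<close>, so
  \<open>\<mu>'\<close> and \<open>\<delta>\<close> vanish to the same order up to there.\<close>

lemma flat_linear_ode:
  assumes "open I" and \<mu>: "\<And>s. s \<in> I \<Longrightarrow> (\<mu> has_real_derivative \<delta> s + n s * \<mu> s) (at s)"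
    and td: "times_diff j n I" "times_diff j \<delta> I" "times_diff j \<mu> I" and "s \<in> I"
  shows "flat (Suc j) \<mu> s \<longleftrightarrow> \<mu> s = 0 \<and> flat j \<delta> s"
  using td
proof (induction j)
  case 0
  show ?case by (simp add: flat_def)
next
  case (Suc j)
  have low: "times_diff j n I" "times_diff j \<delta> I" "times_diff j \<mu> I"
    using Suc.prems by (auto dest: times_diff_SucD simp del: times_diff.simps(2))
  note step = flat_Suc_has_derivative[OF \<open>open I\<close> \<mu> \<open>s \<in> I\<close>]
  have n\<mu>: "times_diff (Suc j) (\<lambda>s. n s * \<mu> s) I"
    using Suc.prems \<open>open I\<close> by (intro times_diff_mult)
  show ?case
  proof
    assume L: "flat (Suc (Suc j)) \<mu> s"
    then have "flat (Suc j) \<mu> s" by (simp add: flat_Suc'[of "Suc j"])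
    then have "flat (Suc j) (\<lambda>s. - n s * \<mu> s) s"
      using Suc.prems \<open>open I\<close> \<open>s \<in> I\<close> by (intro flat_mult[where I = I] times_diff_minus) auto
    moreover have L': "\<mu> s = 0" "flat (Suc j) (\<lambda>s. \<delta> s + n s * \<mu> s) s" using step L by auto
    moreover have "times_diff (Suc j) (\<lambda>s. - n s * \<mu> s) I"
      using times_diff_minus[OF \<open>open I\<close> n\<mu>] by simp
    ultimately have "flat (Suc j) (\<lambda>s. (\<delta> s + n s * \<mu> s) + (- n s * \<mu> s)) s"
      using Suc.prems \<open>s \<in> I\<close> n\<mu>
      by (intro flat_add[OF \<open>open I\<close> times_diff_add[OF \<open>open I\<close>]])
    with L' show "\<mu> s = 0 \<and> flat (Suc j) \<delta> s" by simp
  next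
    assume R: "\<mu> s = 0 \<and> flat (Suc j) \<delta> s"
    then have "flat (Suc j) \<mu> s" using Suc.IH[OF low] by (simp add: flat_Suc'[of j \<delta>])
    then have "flat (Suc j) (\<lambda>s. n s * \<mu> s) s"
      using Suc.prems \<open>open I\<close> \<open>s \<in> I\<close> by (intro flat_mult[where I = I])
    then have "flat (Suc j) (\<lambda>s. \<delta> s + n s * \<mu> s) s"
      using R Suc.prems \<open>open I\<close> \<open>s \<in> I\<close> n\<mu> by (intro flat_add[where I = I]) auto
    then show "flat (Suc (Suc j)) \<mu> s" using step R by auto
  qed
qed

text \<open>This reduces smooth maps of several variables to smooth functions of one variable by restriction to
  a line \<open>p + s v\<close>: for \<open>v = (1, 0)\<close> only \<open>s\<close> moves in \<open>t(s, x)\<close>, for \<open>v = (0, e\<^sub>i)\<close> only \<open>x\<^sub>i\<close>.\<close>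

lemma Ck_on_imp_times_diff:
  fixes f :: "'a::real_normed_vector \<Rightarrow> real"
  assumes "open I" and "\<And>s. s \<in> I \<Longrightarrow> p + s *\<^sub>R v \<in> M" and "Ck_on k f M"
  shows "times_diff k (\<lambda>s. f (p + s *\<^sub>R v)) I"
  using assms(3)
proof (induction k arbitrary: f)
  case (Suc k)
  have "((\<lambda>s. f (p + s *\<^sub>R v)) has_real_derivative frechet_derivative f (at (p + s *\<^sub>R v)) v) (at s)"
    if "s \<in> I" for s
  proof -
    have d: "(f has_derivative frechet_derivative f (at (p + s *\<^sub>R v))) (at (p + s *\<^sub>R v))"
      using Suc.prems assms(2)[OF that] by (simp add: frechet_derivative_works[symmetric])
    have "((\<lambda>s. f (p + s *\<^sub>R v)) has_derivative
        (\<lambda>h. frechet_derivative f (at (p + s *\<^sub>R v)) (h *\<^sub>R v))) (at s)"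
      by (rule has_derivative_compose[where g = f and f = "\<lambda>s. p + s *\<^sub>R v", OF _ d]) (auto intro!: derivative_eq_intros)
    then show ?thesis
      using linear_scale[OF has_derivative_linear[OF d]]
      by (simp add: has_field_derivative_def mult_commute_abs)
  qed
  then show ?case using Suc assms(1) by (intro times_diff_SucI) auto
qed simp

section \<open>The holomorphic curve of a plane map and its conjugate\<close>

text \<open>The pair \<open>(F, H)\<close> encodes \<open>X = (Re F, Re H)\<close> and \<open>c = (Im F, Im H)\<close>, so that
  \<open>X\<^sub>s = (Re F', Re H')\<close> and \<open>X\<^sub>t = - (Im F', Im H')\<close>. All brackets below are written out in these
  real and imaginary parts.\<close>

locale holomorphic_pair =
  fixes F H :: "complex \<Rightarrow> complex" and W :: "complex set"
  assumes open_W: "open W" and holo_F: "F holomorphic_on W" and holo_H: "H holomorphic_on W"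
begin

text \<open>The brackets \<open>gt = [X\<^sub>t, c]\<close> and \<open>gs = [X\<^sub>s, c]\<close> are the partial derivatives of \<open>g\<close>, and
  \<open>jac = [X\<^sub>s, X\<^sub>t]\<close> is \<open>\<delta>\<close>, with the partial derivatives \<open>jac_s\<close>, \<open>jac_t\<close>. The brackets \<open>\<mu> = [X\<^sub>t, x - X]\<close> and
  \<open>\<nu> = [X\<^sub>s, x - X]\<close> depend on the parameter point \<open>x = (x\<^sub>1, x\<^sub>2)\<close>.\<close>

definition gt :: "complex \<Rightarrow> real" where
  "gt z = Im (F z) * Im (deriv H z) - Im (H z) * Im (deriv F z)"

definition gs :: "complex \<Rightarrow> real" where
  "gs z = Re (deriv F z) * Im (H z) - Re (deriv H z) * Im (F z)"

definition jac :: "complex \<Rightarrow> real" where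
  "jac z = Im (deriv F z) * Re (deriv H z) - Re (deriv F z) * Im (deriv H z)"

definition jac_s :: "complex \<Rightarrow> real" where
  "jac_s z = Im (deriv (deriv F) z) * Re (deriv H z) + Im (deriv F z) * Re (deriv (deriv H) z)
     - Re (deriv (deriv F) z) * Im (deriv H z) - Re (deriv F z) * Im (deriv (deriv H) z)"

definition jac_t :: "complex \<Rightarrow> real" where
  "jac_t z = Re (deriv (deriv F) z) * Re (deriv H z) - Im (deriv F z) * Im (deriv (deriv H) z)
     + Im (deriv (deriv F) z) * Im (deriv H z) - Re (deriv F z) * Re (deriv (deriv H) z)"

definition \<mu> :: "real \<Rightarrow> real \<Rightarrow> complex \<Rightarrow> real" where
  "\<mu> x\<^sub>1 x\<^sub>2 z = Im (deriv H z) * (x\<^sub>1 - Re (F z)) - Im (deriv F z) * (x\<^sub>2 - Re (H z))"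

definition \<nu> :: "real \<Rightarrow> real \<Rightarrow> complex \<Rightarrow> real" where
  "\<nu> x\<^sub>1 x\<^sub>2 z = Re (deriv F z) * (x\<^sub>2 - Re (H z)) - Re (deriv H z) * (x\<^sub>1 - Re (F z))"

lemmas holo = holo_F holo_H holomorphic_deriv[OF holo_F open_W] holomorphic_deriv[OF holo_H open_W]
  holomorphic_deriv[OF holomorphic_deriv[OF holo_F open_W] open_W]
  holomorphic_deriv[OF holomorphic_deriv[OF holo_H open_W] open_W]

text \<open>Along \<open>z(\<sigma>) = \<sigma> + i r(\<sigma>)\<close> the derivative of \<open>\<Phi>(z)\<close> is \<open>\<Phi>'(z) (1 + i r')\<close>.\<close>

lemma curve_has_derivative:
  assumes "\<Phi> holomorphic_on W" and "Complex s (r s) \<in> W" and "(r has_real_derivative r') (at s)"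
  shows "((\<lambda>\<sigma>. Re (\<Phi> (Complex \<sigma> (r \<sigma>)))) has_real_derivative
      Re (deriv \<Phi> (Complex s (r s))) - r' * Im (deriv \<Phi> (Complex s (r s)))) (at s)"
    and "((\<lambda>\<sigma>. Im (\<Phi> (Complex \<sigma> (r \<sigma>)))) has_real_derivative
      Im (deriv \<Phi> (Complex s (r s))) + r' * Re (deriv \<Phi> (Complex s (r s)))) (at s)"
proof -
  have \<Phi>: "(\<Phi> has_field_derivative deriv \<Phi> (Complex s (r s))) (at (Complex s (r s)))"
    using holomorphic_derivI[OF assms(1) open_W assms(2)] .
  have "((\<lambda>\<sigma>. of_real \<sigma> + \<i> * of_real (r \<sigma>)) has_vector_derivative (1 + \<i> * of_real r')) (at s)"
    using assms(3) by (auto intro!: derivative_eq_intros has_vector_derivative_of_real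
        simp: has_real_derivative_iff_has_vector_derivative)
  then have "((\<lambda>\<sigma>. Complex \<sigma> (r \<sigma>)) has_vector_derivative Complex 1 r') (at s)"
    by (simp add: Complex_eq)
  from field_vector_diff_chain_at[OF this \<Phi>]
  have V: "((\<lambda>\<sigma>. \<Phi> (Complex \<sigma> (r \<sigma>))) has_vector_derivative
      Complex 1 r' * deriv \<Phi> (Complex s (r s))) (at s)"
    by (simp add: o_def)
  show "((\<lambda>\<sigma>. Re (\<Phi> (Complex \<sigma> (r \<sigma>)))) has_real_derivative
      Re (deriv \<Phi> (Complex s (r s))) - r' * Im (deriv \<Phi> (Complex s (r s)))) (at s)"
    using has_field_derivative_Re[OF V] by simp
  show "((\<lambda>\<sigma>. Im (\<Phi> (Complex \<sigma> (r \<sigma>)))) has_real_derivative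
      Im (deriv \<Phi> (Complex s (r s))) + r' * Re (deriv \<Phi> (Complex s (r s)))) (at s)"
    using has_field_derivative_Im[OF V] by simp
qed

lemma times_diff_curve:
  assumes "open I" and "\<And>k. times_diff k r I" and "\<And>\<sigma>. \<sigma> \<in> I \<Longrightarrow> Complex \<sigma> (r \<sigma>) \<in> W"
    and "\<Phi> holomorphic_on W"
  shows "times_diff k (\<lambda>\<sigma>. Re (\<Phi> (Complex \<sigma> (r \<sigma>)))) I"
    and "times_diff k (\<lambda>\<sigma>. Im (\<Phi> (Complex \<sigma> (r \<sigma>)))) I"
proof -
  have "times_diff k (\<lambda>\<sigma>. Re (\<Phi> (Complex \<sigma> (r \<sigma>)))) I \<and> times_diff k (\<lambda>\<sigma>. Im (\<Phi> (Complex \<sigma> (r \<sigma>)))) I"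
    using assms(4)
  proof (induction k arbitrary: \<Phi>)
    case (Suc k)
    have r: "(r has_real_derivative deriv r \<sigma>) (at \<sigma>)" if "\<sigma> \<in> I" for \<sigma>
      using times_diff_has_derivative[OF assms(2) that] .
    have r': "times_diff k (deriv r) I" using assms(2)[of "Suc k"] by simp
    note IH = Suc.IH[OF holomorphic_deriv[OF Suc.prems open_W]]
    show ?case
    proof
      show "times_diff (Suc k) (\<lambda>\<sigma>. Re (\<Phi> (Complex \<sigma> (r \<sigma>)))) I"
        using assms(1,3) IH r'
        by (intro times_diff_SucI[OF _ curve_has_derivative(1)[OF Suc.prems _ r]])
          (auto intro!: times_diff_diff times_diff_mult)
      show "times_diff (Suc k) (\<lambda>\<sigma>. Im (\<Phi> (Complex \<sigma> (r \<sigma>)))) I"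
        using assms(1,3) IH r'
        by (intro times_diff_SucI[OF _ curve_has_derivative(2)[OF Suc.prems _ r]])
          (auto intro!: times_diff_add times_diff_mult)
    qed
  qed simp
  then show "times_diff k (\<lambda>\<sigma>. Re (\<Phi> (Complex \<sigma> (r \<sigma>)))) I"
    and "times_diff k (\<lambda>\<sigma>. Im (\<Phi> (Complex \<sigma> (r \<sigma>)))) I" by auto
qed

lemma jac_curve:
  assumes "Complex s (r s) \<in> W" and "(r has_real_derivative r') (at s)"
  shows "((\<lambda>\<sigma>. jac (Complex \<sigma> (r \<sigma>))) has_real_derivative
     jac_s (Complex s (r s)) + r' * jac_t (Complex s (r s))) (at s)"
  unfolding jac_def jac_s_def jac_t_def
  apply (rule DERIV_cong)
   apply (rule curve_has_derivative[OF _ assms] derivative_eq_intros refl holo)+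
  by (simp add: algebra_simps)

end

section \<open>The family for a fixed parameter point\<close>

text \<open>Here \<open>x = (x\<^sub>1, x\<^sub>2)\<close> is fixed and \<open>t\<close> is the function \<open>s \<mapsto> t(s, x)\<close>: the point \<open>X(s, t s)\<close> lies on
  the line through \<open>x\<close> in the direction \<open>c(s, t s)\<close>. Up to sign, \<open>gt + \<nu>\<close> is the \<open>t\<close>-derivative of
  \<open>[x - X, c]\<close>, so assumption \<open>\<Delta>_nz\<close> is the solvability of the line equation for \<open>t\<close>. Assumption
  \<open>transversal\<close> says, after division by \<open>gt + \<nu>\<close>, that \<open>c\<close> and its derivative along the curve are
  linearly independent (lemma \<open>turning_nz\<close>); in this form it is a condition on the point \<open>(s, t, x)\<close>
  alone and makes no reference to \<open>t'\<close>.\<close>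

locale pencil_curve = holomorphic_pair +
  fixes I :: "real set" and t :: "real \<Rightarrow> real" and x\<^sub>1 x\<^sub>2 :: real
  assumes open_I: "open I"
    and smooth_t: "\<And>k. times_diff k t I"
    and in_W: "\<And>s. s \<in> I \<Longrightarrow> Complex s (t s) \<in> W"
    and pencil: "\<And>s. s \<in> I \<Longrightarrow>
      (x\<^sub>1 - Re (F (Complex s (t s)))) * Im (H (Complex s (t s)))
        = (x\<^sub>2 - Re (H (Complex s (t s)))) * Im (F (Complex s (t s)))"
    and gt_nz: "\<And>s. s \<in> I \<Longrightarrow> gt (Complex s (t s)) \<noteq> 0"
    and \<Delta>_nz: "\<And>s. s \<in> I \<Longrightarrow> gt (Complex s (t s)) + \<nu> x\<^sub>1 x\<^sub>2 (Complex s (t s)) \<noteq> 0"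
    and transversal: "\<And>s. s \<in> I \<Longrightarrow>
      gt (Complex s (t s)) * (gt (Complex s (t s)) + \<nu> x\<^sub>1 x\<^sub>2 (Complex s (t s)))
        + gs (Complex s (t s)) * (gs (Complex s (t s)) - \<mu> x\<^sub>1 x\<^sub>2 (Complex s (t s))) \<noteq> 0"
begin

abbreviation \<zeta> :: "real \<Rightarrow> complex" where "\<zeta> s \<equiv> Complex s (t s)"
abbreviation m :: "real \<Rightarrow> real" where "m s \<equiv> \<mu> x\<^sub>1 x\<^sub>2 (\<zeta> s)"
abbreviation n :: "real \<Rightarrow> real" where "n s \<equiv> \<nu> x\<^sub>1 x\<^sub>2 (\<zeta> s)"

lemma t': "s \<in> I \<Longrightarrow> (t has_real_derivative deriv t s) (at s)"
  using times_diff_has_derivative[OF smooth_t] .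

lemma smooth_t': "times_diff k (deriv t) I"
  using smooth_t[of "Suc k"] by simp

lemmas chain = curve_has_derivative[OF _ in_W t']

lemma smooth_curve: "\<Phi> holomorphic_on W \<Longrightarrow> times_diff k (\<lambda>s. Re (\<Phi> (\<zeta> s))) I"
    "\<Phi> holomorphic_on W \<Longrightarrow> times_diff k (\<lambda>s. Im (\<Phi> (\<zeta> s))) I"
  using times_diff_curve[OF open_I smooth_t in_W] by blast+

lemma smooth_brackets:
  "times_diff k (\<lambda>s. gt (\<zeta> s)) I" "times_diff k (\<lambda>s. gs (\<zeta> s)) I" "times_diff k (\<lambda>s. jac (\<zeta> s)) I"
  "times_diff k m I" "times_diff k n I" "times_diff k (\<lambda>s. jac_t (\<zeta> s)) I"
  unfolding gt_def gs_def jac_def \<mu>_def \<nu>_def jac_t_def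
  by (intro smooth_curve times_diff_intros open_I holo)+

text \<open>In the plane, \<open>[X\<^sub>t, c] y - [X\<^sub>t, y] c = [y, c] X\<^sub>t\<close>, and here \<open>[y, c] = 0\<close>.\<close>

lemma offset_on_pencil:
  assumes "s \<in> I"
  shows "gt (\<zeta> s) * (x\<^sub>1 - Re (F (\<zeta> s))) = m s * Im (F (\<zeta> s))"
    and "gt (\<zeta> s) * (x\<^sub>2 - Re (H (\<zeta> s))) = m s * Im (H (\<zeta> s))"
  using pencil[OF assms] unfolding gt_def \<mu>_def by algebra+

lemma m_zero_iff:
  assumes "s \<in> I" shows "m s = 0 \<longleftrightarrow> x\<^sub>1 = Re (F (\<zeta> s)) \<and> x\<^sub>2 = Re (H (\<zeta> s))"
proof
  assume "m s = 0"
  then show "x\<^sub>1 = Re (F (\<zeta> s)) \<and> x\<^sub>2 = Re (H (\<zeta> s))"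
    using offset_on_pencil[OF assms] gt_nz[OF assms] by auto
qed (simp add: \<mu>_def)

text \<open>The bracket of \<open>X\<^sub>s\<close> with \<open>g\<^sub>t y = \<mu> c\<close>.\<close>

lemma gt_offset: "s \<in> I \<Longrightarrow> gt (\<zeta> s) * n s = m s * gs (\<zeta> s)"
  using offset_on_pencil[of s] unfolding \<nu>_def gs_def by algebra

text \<open>The \<open>s\<close>-derivative of the line equation \<open>[x - X, c] = 0\<close>, with \<open>c\<^sub>s = - X\<^sub>t\<close> and \<open>c\<^sub>t = X\<^sub>s\<close>.\<close>

lemma velocity:
  assumes "s \<in> I"
  shows "deriv t s * (gt (\<zeta> s) + n s) = m s - gs (\<zeta> s)"
proof -
  let ?p = "\<lambda>s. (x\<^sub>1 - Re (F (\<zeta> s))) * Im (H (\<zeta> s)) - (x\<^sub>2 - Re (H (\<zeta> s))) * Im (F (\<zeta> s))"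
  have "(?p has_real_derivative m s - gs (\<zeta> s) - deriv t s * (gt (\<zeta> s) + n s)) (at s)"
    unfolding gt_def gs_def \<mu>_def \<nu>_def
    apply (rule DERIV_cong)
     apply (rule chain derivative_eq_intros refl holo assms)+
    by (simp add: algebra_simps)
  moreover have "(?p has_real_derivative 0) (at s)"
    by (rule has_field_derivative_transform_within_open[OF DERIV_const open_I assms, of 0])
      (use pencil in simp)
  ultimately show ?thesis using DERIV_unique by fastforce
qed

text \<open>This is \<open>[c, c']\<close> for the derivative \<open>c' = - X\<^sub>t + t' X\<^sub>s\<close> of \<open>c\<close> along the curve.\<close>

definition turning :: "real \<Rightarrow> real" where "turning s = gt (\<zeta> s) - deriv t s * gs (\<zeta> s)"

lemma turning_nz: assumes "s \<in> I" shows "turning s \<noteq> 0"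
proof
  assume "turning s = 0"
  then have "gt (\<zeta> s) * (gt (\<zeta> s) + n s) = deriv t s * (gt (\<zeta> s) + n s) * gs (\<zeta> s)"
    unfolding turning_def by algebra
  then show False using transversal[OF assms] velocity[OF assms] by algebra
qed

text \<open>The left-hand side is the \<open>s\<close>-derivative of \<open>g(s, t s)\<close>. It has \<open>\<mu>\<close> as a factor since by \<open>velocity\<close>
  and \<open>gt_offset\<close> the slope \<open>t'\<close> equals \<open>- g\<^sub>s / g\<^sub>t\<close> up to a multiple of \<open>\<mu>\<close>.\<close>

lemma slope_factor:
  assumes "s \<in> I"
  shows "gs (\<zeta> s) + deriv t s * gt (\<zeta> s) = (turning s / gt (\<zeta> s)) * m s"
proof -
  have "gt (\<zeta> s) * (gs (\<zeta> s) + deriv t s * gt (\<zeta> s)) = turning s * m s"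
    using velocity[OF assms] gt_offset[OF assms] unfolding turning_def by algebra
  then show ?thesis using gt_nz[OF assms] by (simp add: field_simps)
qed

text \<open>In the derivative of \<open>\<mu> = [X\<^sub>t, y]\<close>, the term \<open>[X\<^sub>t, y']\<close> with \<open>y' = - X\<^sub>s - t' X\<^sub>t\<close> is \<open>\<delta>\<close>, and the term
  with the derivative of \<open>X\<^sub>t\<close> is linear in \<open>y = (\<mu> / g\<^sub>t) c\<close>, hence a multiple of \<open>\<mu>\<close>.\<close>

lemma m_ode:
  assumes "s \<in> I"
  shows "(m has_real_derivative jac (\<zeta> s) +
    ((Im (deriv (deriv H) (\<zeta> s)) + deriv t s * Re (deriv (deriv H) (\<zeta> s))) * Im (F (\<zeta> s))
      - (Im (deriv (deriv F) (\<zeta> s)) + deriv t s * Re (deriv (deriv F) (\<zeta> s))) * Im (H (\<zeta> s)))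
      / gt (\<zeta> s) * m s) (at s)"
proof -
  let ?h = "Im (deriv (deriv H) (\<zeta> s)) + deriv t s * Re (deriv (deriv H) (\<zeta> s))"
  let ?f = "Im (deriv (deriv F) (\<zeta> s)) + deriv t s * Re (deriv (deriv F) (\<zeta> s))"
  have y: "x\<^sub>1 - Re (F (\<zeta> s)) = m s * Im (F (\<zeta> s)) / gt (\<zeta> s)"
      "x\<^sub>2 - Re (H (\<zeta> s)) = m s * Im (H (\<zeta> s)) / gt (\<zeta> s)"
    using offset_on_pencil[OF assms] gt_nz[OF assms] by (simp_all add: field_simps)
  have "(m has_real_derivative jac (\<zeta> s) + ?h * (x\<^sub>1 - Re (F (\<zeta> s))) - ?f * (x\<^sub>2 - Re (H (\<zeta> s)))) (at s)"
    unfolding \<mu>_def jac_def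
    apply (rule DERIV_cong)
     apply (rule chain derivative_eq_intros refl holo assms)+
    by (simp add: algebra_simps)
  then show ?thesis unfolding y using gt_nz[OF assms] by (simp add: diff_divide_distrib algebra_simps)
qed

lemma smooth_ode_coefficient:
  "times_diff k (\<lambda>s. ((Im (deriv (deriv H) (\<zeta> s)) + deriv t s * Re (deriv (deriv H) (\<zeta> s))) * Im (F (\<zeta> s))
      - (Im (deriv (deriv F) (\<zeta> s)) + deriv t s * Re (deriv (deriv F) (\<zeta> s))) * Im (H (\<zeta> s)))
      / gt (\<zeta> s)) I"
  by (intro smooth_curve smooth_brackets smooth_t' times_diff_intros open_I holo gt_nz)

lemma smooth_turning: "times_diff k (\<lambda>s. turning s / gt (\<zeta> s)) I"
  unfolding turning_def
  by (intro smooth_brackets smooth_t' times_diff_intros open_I gt_nz)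

lemma flat_m: "s \<in> I \<Longrightarrow> flat (Suc j) m s \<longleftrightarrow> m s = 0 \<and> flat j (\<lambda>s. jac (\<zeta> s)) s"
  by (rule flat_linear_ode[OF open_I m_ode smooth_ode_coefficient smooth_brackets(3,4)])

lemma flat_slope:
  assumes "s \<in> I"
  shows "flat j (\<lambda>s. gs (\<zeta> s) + deriv t s * gt (\<zeta> s)) s \<longleftrightarrow> flat j m s"
proof -
  have "flat j (\<lambda>s. gs (\<zeta> s) + deriv t s * gt (\<zeta> s)) s \<longleftrightarrow> flat j (\<lambda>s. (turning s / gt (\<zeta> s)) * m s) s"
    by (rule flat_cong[OF open_I slope_factor assms])
  also have "\<dots> \<longleftrightarrow> flat j m s"
    using turning_nz gt_nz by (intro flat_mult_nonzero_iff[OF open_I smooth_turning smooth_brackets(4) assms]) simp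
  finally show ?thesis .
qed

text \<open>All cases \<open>k = j + 1\<close> at once: \<open>G\<^sub>s\<close> vanishes to the same order as \<open>\<mu>\<close>, and \<open>\<mu>\<close> to one order more than
  \<open>\<delta>\<close>.\<close>

lemma A_point_iff:
  assumes G: "\<And>s. s \<in> I \<Longrightarrow> ((\<lambda>\<sigma>. G \<sigma> x) has_real_derivative gs (\<zeta> s) + deriv t s * gt (\<zeta> s)) (at s)"
    and s: "s \<in> I"
  shows "is_A_point (Suc j) G s x \<longleftrightarrow>
    m s = 0 \<and> flat j (\<lambda>\<sigma>. jac (\<zeta> \<sigma>)) s \<and> (deriv ^^ j) (\<lambda>\<sigma>. jac (\<zeta> \<sigma>)) s \<noteq> 0"
proof -
  let ?h = "\<lambda>s. gs (\<zeta> s) + deriv t s * gt (\<zeta> s)"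
  have D: "(deriv ^^ Suc i) (\<lambda>\<sigma>. G \<sigma> x) s = (deriv ^^ i) ?h s" for i
    by (rule iterated_deriv_Suc[OF open_I G s])
  have "(\<forall>i\<in>{1..Suc j}. (deriv ^^ i) (\<lambda>\<sigma>. G \<sigma> x) s = 0) \<longleftrightarrow> flat (Suc j) ?h s"
    unfolding flat_def D[symmetric] 
    by (metis Suc_le_eq Suc_le_mono atLeastAtMost_iff le_add1 less_Suc_eq_le not0_implies_Suc not_one_le_zero plus_1_eq_Suc)
  then have "is_A_point (Suc j) G s x \<longleftrightarrow> flat (Suc j) ?h s \<and> \<not> flat (Suc (Suc j)) ?h s"
    unfolding is_A_point_def flat_Suc'[of "Suc j"] Suc_eq_plus1[symmetric] D by auto
  then show ?thesis
    by (auto simp: flat_slope[OF s] flat_m[OF s] flat_Suc'[of j])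
qed

end

section \<open>Contact with the singular curve\<close>

context holomorphic_pair
begin

text \<open>Up to the factor \<open>gt\<close>, this is the derivative of \<open>\<delta>\<close> in the direction \<open>(1, - g\<^sub>s / g\<^sub>t)\<close>, which on the
  singular curve is the kernel direction \<open>(1, \<alpha>)\<close> of the differential of \<open>X\<close>.\<close>

definition jac_null :: "complex \<Rightarrow> real" where "jac_null z = gt z * jac_s z - gs z * jac_t z"

text \<open>By the chain rule the derivative \<open>d\<close> along a graph depends only on the point and the slope, so
  graphs that are tangent at \<open>s\<close> share it.\<close>

lemma jac_null_same_velocity:
  assumes "Complex s (q s) \<in> W" and "q s = r s"
    and "(q has_real_derivative v) (at s)" and "(r has_real_derivative v) (at s)"
  shows "\<exists>d. ((\<lambda>\<sigma>. jac_null (Complex \<sigma> (q \<sigma>))) has_real_derivative d) (at s) \<and>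
    ((\<lambda>\<sigma>. jac_null (Complex \<sigma> (r \<sigma>))) has_real_derivative d) (at s)"
proof -
  have r: "Complex s (r s) \<in> W" using assms by simp
  show ?thesis
    unfolding jac_null_def gt_def gs_def jac_s_def jac_t_def
    apply (intro exI conjI)
     apply ((rule curve_has_derivative[OF _ assms(1,3)] derivative_eq_intros refl holo)+)[1]
    apply (rule DERIV_cong)
     apply (rule curve_has_derivative[OF _ r assms(4)] derivative_eq_intros refl holo)+
    by (simp add: assms(2))
qed

end

context pencil_curve
begin

lemma slope_on_X:
  assumes "s \<in> I" and "m s = 0" shows "gs (\<zeta> s) + deriv t s * gt (\<zeta> s) = 0"
  using slope_factor[OF assms(1)] assms(2) by simp

lemma jac_has_derivative:
  "s \<in> I \<Longrightarrow> ((\<lambda>\<sigma>. jac (\<zeta> \<sigma>)) has_real_derivative jac_s (\<zeta> s) + deriv t s * jac_t (\<zeta> s)) (at s)"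
  by (rule jac_curve[OF in_W t'])

text \<open>The singular curve is the graph of \<open>\<tau>\<close>. The condition on \<open>\<alpha>\<close> is the bracket with \<open>c\<close> of
  \<open>X\<^sub>s + \<alpha> X\<^sub>t = 0\<close>. The point \<open>s\<close> is one where \<open>x = X(s, t s)\<close> lies on the image of the singular curve.\<close>

context
  fixes \<tau> \<alpha> :: "real \<Rightarrow> real" and s :: real
  assumes smooth_\<tau>: "\<And>k. times_diff k \<tau> I"
    and \<tau>_in_W: "\<And>\<sigma>. \<sigma> \<in> I \<Longrightarrow> Complex \<sigma> (\<tau> \<sigma>) \<in> W"
    and singular: "\<And>\<sigma>. \<sigma> \<in> I \<Longrightarrow> jac (Complex \<sigma> (\<tau> \<sigma>)) = 0"
    and gt_\<tau>: "\<And>\<sigma>. \<sigma> \<in> I \<Longrightarrow> gt (Complex \<sigma> (\<tau> \<sigma>)) \<noteq> 0"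
    and \<alpha>: "\<And>\<sigma>. \<sigma> \<in> I \<Longrightarrow> gs (Complex \<sigma> (\<tau> \<sigma>)) + \<alpha> \<sigma> * gt (Complex \<sigma> (\<tau> \<sigma>)) = 0"
    and s: "s \<in> I" and m0: "m s = 0" and t_\<tau>: "t s = \<tau> s" and jt: "jac_t (\<zeta> s) \<noteq> 0"
begin

lemma \<tau>': "\<sigma> \<in> I \<Longrightarrow> (\<tau> has_real_derivative deriv \<tau> \<sigma>) (at \<sigma>)"
  using times_diff_has_derivative[OF smooth_\<tau>] .

lemma jac_along_\<tau>:
  assumes "\<sigma> \<in> I"
  shows "jac_s (Complex \<sigma> (\<tau> \<sigma>)) + deriv \<tau> \<sigma> * jac_t (Complex \<sigma> (\<tau> \<sigma>)) = 0"
proof -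
  have "((\<lambda>\<sigma>. jac (Complex \<sigma> (\<tau> \<sigma>))) has_real_derivative 0) (at \<sigma>)"
    by (rule has_field_derivative_transform_within_open[OF DERIV_const open_I assms, of 0])
      (simp add: singular)
  then show ?thesis using jac_curve[OF \<tau>_in_W \<tau>'] assms DERIV_unique by blast
qed

text \<open>Both slopes solve \<open>g\<^sub>s + a g\<^sub>t = 0\<close> for \<open>a\<close>.\<close>

lemma t'_eq_\<alpha>: "deriv t s = \<alpha> s"
proof -
  have "(deriv t s - \<alpha> s) * gt (\<zeta> s) = 0"
    using slope_on_X[OF s m0] \<alpha>[OF s, folded t_\<tau>] by algebra
  then show ?thesis using gt_nz[OF s] by simp
qed

lemma jac_deriv_eq: "deriv (\<lambda>\<sigma>. jac (\<zeta> \<sigma>)) s = (\<alpha> s - deriv \<tau> s) * jac_t (\<zeta> s)"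
  using jac_has_derivative[OF s, THEN DERIV_imp_deriv] jac_along_\<tau>[OF s] t'_eq_\<alpha> t_\<tau>
  by (simp add: algebra_simps)

lemma jac_deriv_nonzero_iff: "deriv (\<lambda>\<sigma>. jac (\<zeta> \<sigma>)) s \<noteq> 0 \<longleftrightarrow> \<alpha> s \<noteq> deriv \<tau> s"
  using jac_deriv_eq jt by simp

text \<open>The defining equation determines \<open>\<alpha>\<close> as \<open>- g\<^sub>s / g\<^sub>t\<close> on the singular curve, which makes it smooth.\<close>

lemma \<alpha>_has_derivative: "(\<alpha> has_real_derivative deriv \<alpha> s) (at s)"
proof -
  let ?q = "\<lambda>\<sigma>. - gs (Complex \<sigma> (\<tau> \<sigma>)) / gt (Complex \<sigma> (\<tau> \<sigma>))"
  have td: "times_diff (Suc 0) ?q I"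
    unfolding gs_def
    using gt_\<tau> unfolding gt_def
    by (intro times_diff_intros open_I times_diff_curve[OF open_I smooth_\<tau> \<tau>_in_W] holo)
  moreover have "?q \<sigma> = \<alpha> \<sigma>" if "\<sigma> \<in> I" for \<sigma>
    using \<alpha>[OF that] gt_\<tau>[OF that] by (simp add: field_simps)
  ultimately have "times_diff (Suc 0) \<alpha> I"
    by (intro times_diff_cong[OF open_I, of ?q \<alpha> "Suc 0"])
  then show ?thesis using times_diff_has_derivative s by blast
qed

text \<open>Write \<open>h\<close> for the derivative of \<open>\<delta>\<close> along \<open>t\<close>, and \<open>w\<close> for \<open>jac_null\<close>. Along \<open>t\<close> one has
  \<open>w = g\<^sub>t h - r \<mu>\<close>, where \<open>h\<close>, \<open>\<mu>\<close> and \<open>\<mu>'\<close> vanish at \<open>s\<close>, so \<open>w' = g\<^sub>t h'\<close> there. Along \<open>\<tau>\<close> one has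
  \<open>w = (\<alpha> - \<tau>') g\<^sub>t \<delta>\<^sub>t\<close>, where the first factor vanishes at \<open>s\<close>, so \<open>w' = (\<alpha>' - \<tau>'') g\<^sub>t \<delta>\<^sub>t\<close>. The two values
  of \<open>w'\<close> agree by tangency.\<close>

lemma jac_deriv2_eq:
  assumes "\<alpha> s = deriv \<tau> s" and "jac (\<zeta> s) = 0"
  shows "deriv (deriv (\<lambda>\<sigma>. jac (\<zeta> \<sigma>))) s = (deriv \<alpha> s - deriv (deriv \<tau>) s) * jac_t (\<zeta> s)"
proof -
  let ?h = "deriv (\<lambda>\<sigma>. jac (\<zeta> \<sigma>))"
  have h: "?h \<sigma> = jac_s (\<zeta> \<sigma>) + deriv t \<sigma> * jac_t (\<zeta> \<sigma>)" if "\<sigma> \<in> I" for \<sigma>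
    using jac_has_derivative[OF that] by (rule DERIV_imp_deriv)
  have h0: "?h s = 0" using jac_deriv_eq assms by simp
  have "times_diff 2 (\<lambda>\<sigma>. jac (\<zeta> \<sigma>)) I" by (rule smooth_brackets)
  then have h': "(?h has_real_derivative deriv ?h s) (at s)"
    using times_diff_has_derivative[of 0 ?h I s] s by (simp add: numeral_2_eq_2)
  obtain d where d_t: "((\<lambda>\<sigma>. jac_null (\<zeta> \<sigma>)) has_real_derivative d) (at s)"
    and d_\<tau>: "((\<lambda>\<sigma>. jac_null (Complex \<sigma> (\<tau> \<sigma>))) has_real_derivative d) (at s)"
    using jac_null_same_velocity[where q = t and r = \<tau>, OF in_W[OF s] t_\<tau> t'[OF s]] \<tau>'[OF s] t'_eq_\<alpha> assms(1) by auto
  have gt': "((\<lambda>\<sigma>. gt (\<zeta> \<sigma>)) has_real_derivative deriv (\<lambda>\<sigma>. gt (\<zeta> \<sigma>)) s) (at s)"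
    using times_diff_has_derivative[OF smooth_brackets(1) s] .
  let ?r = "\<lambda>\<sigma>. (turning \<sigma> / gt (\<zeta> \<sigma>)) * jac_t (\<zeta> \<sigma>)"
  have r': "(?r has_real_derivative deriv ?r s) (at s)"
    by (rule times_diff_has_derivative[OF times_diff_mult[OF open_I smooth_turning smooth_brackets(6)] s])
  have m': "(m has_real_derivative 0) (at s)"
    using m_ode[OF s] m0 assms(2) by simp
  have "((\<lambda>\<sigma>. gt (\<zeta> \<sigma>) * ?h \<sigma> - ?r \<sigma> * m \<sigma>) has_real_derivative gt (\<zeta> s) * deriv ?h s) (at s)"
    by (rule DERIV_cong, (rule derivative_eq_intros gt' h' r' m' refl)+) (simp add: h0 m0)
  then have "((\<lambda>\<sigma>. jac_null (\<zeta> \<sigma>)) has_real_derivative gt (\<zeta> s) * deriv ?h s) (at s)"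
  proof (rule has_field_derivative_transform_within_open[OF _ open_I s])
    fix \<sigma> assume "\<sigma> \<in> I"
    then show "gt (\<zeta> \<sigma>) * ?h \<sigma> - ?r \<sigma> * m \<sigma> = jac_null (\<zeta> \<sigma>)"
      using slope_factor[of \<sigma>] unfolding jac_null_def h[OF \<open>\<sigma> \<in> I\<close>] by algebra
  qed
  then have 1: "gt (\<zeta> s) * deriv ?h s = d" using d_t DERIV_unique by blast
  let ?e = "\<lambda>\<sigma>. gt (Complex \<sigma> (\<tau> \<sigma>)) * jac_t (Complex \<sigma> (\<tau> \<sigma>))"
  have "times_diff (Suc 0) ?e I"
    unfolding gt_def jac_t_def
    by (intro times_diff_intros open_I times_diff_curve[OF open_I smooth_\<tau> \<tau>_in_W] holo)
  then have e': "(?e has_real_derivative deriv ?e s) (at s)"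
    using times_diff_has_derivative s by blast
  have \<tau>'': "(deriv \<tau> has_real_derivative deriv (deriv \<tau>) s) (at s)"
    using times_diff_has_derivative[of 0 "deriv \<tau>" I s] s smooth_\<tau>[of 2] by (simp add: numeral_2_eq_2)
  have "((\<lambda>\<sigma>. (\<alpha> \<sigma> - deriv \<tau> \<sigma>) * ?e \<sigma>) has_real_derivative
      (deriv \<alpha> s - deriv (deriv \<tau>) s) * ?e s) (at s)"
    by (rule DERIV_cong, (rule derivative_eq_intros e' \<alpha>_has_derivative \<tau>'' refl)+) (simp add: assms(1))
  then have "((\<lambda>\<sigma>. jac_null (Complex \<sigma> (\<tau> \<sigma>))) has_real_derivative
      (deriv \<alpha> s - deriv (deriv \<tau>) s) * ?e s) (at s)"
  proof (rule has_field_derivative_transform_within_open[OF _ open_I s])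
    fix \<sigma> assume "\<sigma> \<in> I"
    then show "(\<alpha> \<sigma> - deriv \<tau> \<sigma>) * ?e \<sigma> = jac_null (Complex \<sigma> (\<tau> \<sigma>))"
      using jac_along_\<tau>[of \<sigma>] \<alpha>[of \<sigma>] unfolding jac_null_def by algebra
  qed
  then have "d = (deriv \<alpha> s - deriv (deriv \<tau>) s) * ?e s" using d_\<tau> DERIV_unique by blast
  with 1 show ?thesis using gt_nz[OF s] t_\<tau> by (simp add: mult.assoc mult.left_commute)
qed

lemma jac_deriv2_nonzero_iff:
  assumes "jac (\<zeta> s) = 0"
  shows "deriv (\<lambda>\<sigma>. jac (\<zeta> \<sigma>)) s = 0 \<and> (deriv ^^ 2) (\<lambda>\<sigma>. jac (\<zeta> \<sigma>)) s \<noteq> 0 \<longleftrightarrow>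
    \<alpha> s = deriv \<tau> s \<and> deriv \<alpha> s \<noteq> (deriv ^^ 2) \<tau> s"
  using jac_deriv_nonzero_iff jac_deriv2_eq[OF _ assms] jt by (auto simp: numeral_2_eq_2)

end

section \<open>Versality\<close>

lemma c_has_derivative:
  assumes "s \<in> I"
  shows "((\<lambda>\<sigma>. Im (F (\<zeta> \<sigma>))) has_real_derivative
      Im (deriv F (\<zeta> s)) + deriv t s * Re (deriv F (\<zeta> s))) (at s)"
    and "((\<lambda>\<sigma>. Im (H (\<zeta> \<sigma>))) has_real_derivative
      Im (deriv H (\<zeta> s)) + deriv t s * Re (deriv H (\<zeta> s))) (at s)"
  using chain(2)[OF holo_F assms] chain(2)[OF holo_H assms] assms by auto

lemma c_deriv_nonzero:
  assumes "s \<in> I"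
  shows "deriv (\<lambda>\<sigma>. Im (F (\<zeta> \<sigma>))) s \<noteq> 0 \<or> deriv (\<lambda>\<sigma>. Im (H (\<zeta> \<sigma>))) s \<noteq> 0"
proof (rule ccontr)
  assume "\<not> ?thesis"
  then have "Im (deriv F (\<zeta> s)) + deriv t s * Re (deriv F (\<zeta> s)) = 0"
      "Im (deriv H (\<zeta> s)) + deriv t s * Re (deriv H (\<zeta> s)) = 0"
    using c_has_derivative[OF assms, THEN DERIV_imp_deriv] by simp_all
  then have "turning s = 0" unfolding turning_def gt_def gs_def by algebra
  then show False using turning_nz[OF assms] by simp
qed

lemma c_deriv2:
  assumes "s \<in> I"
  shows "deriv (deriv (\<lambda>\<sigma>. Im (F (\<zeta> \<sigma>)))) s =
      Im (deriv (deriv F) (\<zeta> s)) + 2 * deriv t s * Re (deriv (deriv F) (\<zeta> s))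
      - deriv t s * deriv t s * Im (deriv (deriv F) (\<zeta> s)) + deriv (deriv t) s * Re (deriv F (\<zeta> s))" (is ?f)
    and "deriv (deriv (\<lambda>\<sigma>. Im (H (\<zeta> \<sigma>)))) s =
      Im (deriv (deriv H) (\<zeta> s)) + 2 * deriv t s * Re (deriv (deriv H) (\<zeta> s))
      - deriv t s * deriv t s * Im (deriv (deriv H) (\<zeta> s)) + deriv (deriv t) s * Re (deriv H (\<zeta> s))" (is ?h)
proof -
  have t'': "(deriv t has_real_derivative deriv (deriv t) s) (at s)"
    using times_diff_has_derivative[OF smooth_t' assms] .
  show ?f
    apply (subst iterated_deriv_Suc[where j = 1, simplified, OF open_I c_has_derivative(1) assms])
     apply simp
    apply (rule DERIV_imp_deriv, rule DERIV_cong)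
     apply (rule chain derivative_eq_intros refl holo assms t'')+
    by (simp add: algebra_simps)
  show ?h
    apply (subst iterated_deriv_Suc[where j = 1, simplified, OF open_I c_has_derivative(2) assms])
     apply simp
    apply (rule DERIV_imp_deriv, rule DERIV_cong)
     apply (rule chain derivative_eq_intros refl holo assms t'')+
    by (simp add: algebra_simps)
qed

text \<open>At such a point \<open>X\<^sub>s + a X\<^sub>t = 0\<close> with \<open>a = t'\<close>, so \<open>F' = (a + i) f\<close> and \<open>H' = (a + i) h\<close> with real
  \<open>f\<close>, \<open>h\<close>. Put \<open>W = h F'' - f H'' = p + i q\<close> and \<open>z' = 1 + i a\<close>. The derivative of \<open>\<delta>\<close> along the curve
  is, up to sign, the real part of \<open>z'\<^sup>2 W\<close>, and \<open>[c', c'']\<close> is, up to the factor \<open>1 + a\<^sup>2\<close> and sign, the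
  imaginary part. If both vanish, then \<open>W = 0\<close> and with it \<open>\<delta>\<^sub>t\<close>.\<close>

lemma c_curvature_nonzero:
  assumes s: "s \<in> I" and m0: "m s = 0" and jac0: "jac (\<zeta> s) = 0"
    and jac1: "deriv (\<lambda>\<sigma>. jac (\<zeta> \<sigma>)) s = 0" and jt: "jac_t (\<zeta> s) \<noteq> 0"
  shows "deriv (\<lambda>\<sigma>. Im (F (\<zeta> \<sigma>))) s * deriv (deriv (\<lambda>\<sigma>. Im (H (\<zeta> \<sigma>)))) s
    \<noteq> deriv (\<lambda>\<sigma>. Im (H (\<zeta> \<sigma>))) s * deriv (deriv (\<lambda>\<sigma>. Im (F (\<zeta> \<sigma>)))) s"
proof
  assume eq: "deriv (\<lambda>\<sigma>. Im (F (\<zeta> \<sigma>))) s * deriv (deriv (\<lambda>\<sigma>. Im (H (\<zeta> \<sigma>)))) s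
    = deriv (\<lambda>\<sigma>. Im (H (\<zeta> \<sigma>))) s * deriv (deriv (\<lambda>\<sigma>. Im (F (\<zeta> \<sigma>)))) s"
  define a where "a = deriv t s"
  define f where "f = Im (deriv F (\<zeta> s))"
  define h where "h = Im (deriv H (\<zeta> s))"
  define f' where "f' = Re (deriv F (\<zeta> s))"
  define h' where "h' = Re (deriv H (\<zeta> s))"
  have sl: "gs (\<zeta> s) + a * gt (\<zeta> s) = 0" using slope_on_X[OF s m0] by (simp add: a_def)
  have j0: "f * h' = f' * h" using jac0 by (simp add: jac_def f_def h_def f'_def h'_def)
  \<comment> \<open>The vector \<open>X\<^sub>s + a X\<^sub>t\<close> has zero bracket with \<open>X\<^sub>t\<close> and with \<open>c\<close>, which are linearly independent.\<close>
  have "gt (\<zeta> s) * (f' - a * f) = 0" "gt (\<zeta> s) * (h' - a * h) = 0"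
    using sl j0 unfolding gt_def gs_def f_def[symmetric] h_def[symmetric] f'_def[symmetric] h'_def[symmetric]
    by algebra+
  then have f': "f' = a * f" and h': "h' = a * h" using gt_nz[OF s] by auto
  define p where "p = h * Re (deriv (deriv F) (\<zeta> s)) - f * Re (deriv (deriv H) (\<zeta> s))"
  define q where "q = h * Im (deriv (deriv F) (\<zeta> s)) - f * Im (deriv (deriv H) (\<zeta> s))"
  have "jac_s (\<zeta> s) + a * jac_t (\<zeta> s) = 0"
    using jac1 DERIV_imp_deriv[OF jac_has_derivative[OF s]] by (simp add: a_def)
  then have 1: "2 * a * q - (1 - a * a) * p = 0"
    unfolding jac_s_def jac_t_def f_def[symmetric] h_def[symmetric] f'_def[symmetric] h'_def[symmetric]
      f' h' p_def q_def by algebra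
  have "(1 + a * a) * ((1 - a * a) * q + 2 * a * p) = 0"
    using eq unfolding c_deriv2[OF s] c_has_derivative[OF s, THEN DERIV_imp_deriv] 
      a_def[symmetric] f_def[symmetric] h_def[symmetric] f'_def[symmetric] h'_def[symmetric]
      f' h' p_def q_def by algebra
  moreover have pos: "1 + a * a > 0" using zero_le_square[of a] by linarith
  ultimately have 2: "(1 - a * a) * q + 2 * a * p = 0" by simp
  \<comment> \<open>The two linear equations for \<open>(p, q)\<close> have determinant \<open>\<plusminus> ((1 - a\<^sup>2)\<^sup>2 + (2 a)\<^sup>2) = \<plusminus> (1 + a\<^sup>2)\<^sup>2\<close>.\<close>
  have "(1 + a * a) * (1 + a * a) * p = 0" "(1 + a * a) * (1 + a * a) * q = 0"
    using 1 2 by algebra+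
  then have "p = 0" "q = 0" using pos by auto
  then have "jac_t (\<zeta> s) = 0"
    unfolding jac_t_def f_def[symmetric] h_def[symmetric] f'_def[symmetric] h'_def[symmetric]
      f' h' p_def q_def by algebra
  then show False using jt by simp
qed

text \<open>The hypothesis on \<open>u\<close> is the equation for a parameter derivative \<open>u\<close> of \<open>G\<close>, with \<open>v = [e\<^sub>i, c]\<close>. Since
  \<open>g\<^sub>t \<nu> = \<mu> g\<^sub>s\<close>, it gives \<open>u = v + r \<mu>\<close> with a smooth \<open>r\<close>, and \<open>r \<mu>\<close> has no effect on the derivatives
  of order at most \<open>j\<close>.\<close>

lemma unfolding_direction_jet:
  assumes s: "s \<in> I" and flat: "flat (Suc j) m s" and v: "times_diff (Suc j) v I"
    and u: "\<And>\<sigma>. \<sigma> \<in> I \<Longrightarrow> u \<sigma> * (gt (\<zeta> \<sigma>) + n \<sigma>) = v \<sigma> * gt (\<zeta> \<sigma>)"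
  shows "(deriv ^^ j) u s = (deriv ^^ j) v s"
proof -
  let ?r = "\<lambda>\<sigma>. - (v \<sigma> * gs (\<zeta> \<sigma>)) / (gt (\<zeta> \<sigma>) * (gt (\<zeta> \<sigma>) + n \<sigma>))"
  have r: "times_diff (Suc j) ?r I"
    using gt_nz \<Delta>_nz
    by (intro times_diff_intros smooth_brackets v open_I) auto
  have "u \<sigma> = v \<sigma> + ?r \<sigma> * m \<sigma>" if "\<sigma> \<in> I" for \<sigma>
  proof -
    have "gt (\<zeta> \<sigma>) * (gt (\<zeta> \<sigma>) + n \<sigma>) * u \<sigma> = gt (\<zeta> \<sigma>) * (gt (\<zeta> \<sigma>) + n \<sigma>) * v \<sigma> - v \<sigma> * gs (\<zeta> \<sigma>) * m \<sigma>"
      using u[OF that] gt_offset[OF that] by algebra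
    moreover have "gt (\<zeta> \<sigma>) * (gt (\<zeta> \<sigma>) + n \<sigma>) * (?r \<sigma> * m \<sigma>) = - (v \<sigma> * gs (\<zeta> \<sigma>)) * m \<sigma>"
      using gt_nz[OF that] \<Delta>_nz[OF that] by simp
    ultimately have "gt (\<zeta> \<sigma>) * (gt (\<zeta> \<sigma>) + n \<sigma>) * u \<sigma> = gt (\<zeta> \<sigma>) * (gt (\<zeta> \<sigma>) + n \<sigma>) * (v \<sigma> + ?r \<sigma> * m \<sigma>)"
      by algebra
    then show ?thesis using gt_nz[OF that] \<Delta>_nz[OF that] by simp
  qed
  then have "(deriv ^^ j) u s = (deriv ^^ j) (\<lambda>\<sigma>. v \<sigma> + ?r \<sigma> * m \<sigma>) s"
    by (rule iterated_deriv_cong[OF open_I _ s])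
  also have "\<dots> = (deriv ^^ j) v s + (deriv ^^ j) (\<lambda>\<sigma>. ?r \<sigma> * m \<sigma>) s"
    by (rule iterated_deriv_add[OF open_I times_diff_SucD[OF v]
          times_diff_SucD[OF times_diff_mult[OF open_I r smooth_brackets(4)]] s])
  also have "(deriv ^^ j) (\<lambda>\<sigma>. ?r \<sigma> * m \<sigma>) s = 0"
    using flat_mult[OF open_I r smooth_brackets(4) s flat] by (simp add: flat_def)
  finally show ?thesis by simp
qed

text \<open>For \<open>k = 2\<close> the given number is attained by a multiple of the nonzero vector \<open>(p 1, q 1)\<close>; for \<open>k = 3\<close>
  the given pair is attained by Cramer's rule. Here \<open>p j\<close> and \<open>q j\<close> are the \<open>j\<close>-th derivatives of
  \<open>[e\<^sub>1, c]\<close> and \<open>[e\<^sub>2, c]\<close>.\<close>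

lemma versal_if_A_point:
  assumes G\<^sub>1: "\<And>\<sigma>. \<sigma> \<in> I \<Longrightarrow>
      param_deriv G 1 \<sigma> x * (gt (\<zeta> \<sigma>) + n \<sigma>) = Im (H (\<zeta> \<sigma>)) * gt (\<zeta> \<sigma>)"
    and G\<^sub>2: "\<And>\<sigma>. \<sigma> \<in> I \<Longrightarrow>
      param_deriv G 2 \<sigma> x * (gt (\<zeta> \<sigma>) + n \<sigma>) = - Im (F (\<zeta> \<sigma>)) * gt (\<zeta> \<sigma>)"
    and s: "s \<in> I" and m0: "m s = 0" and jac0: "jac (\<zeta> s) = 0"
  shows "versal_at 2 G s x"
    and "deriv (\<lambda>\<sigma>. jac (\<zeta> \<sigma>)) s = 0 \<Longrightarrow> jac_t (\<zeta> s) \<noteq> 0 \<Longrightarrow> versal_at 3 G s x"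
proof -
  define p where "p j = (deriv ^^ j) (\<lambda>\<sigma>. Im (H (\<zeta> \<sigma>))) s" for j
  define q where "q j = - (deriv ^^ j) (\<lambda>\<sigma>. Im (F (\<zeta> \<sigma>))) s" for j
  have jet: "(deriv ^^ j) (\<lambda>\<sigma>. param_deriv G 1 \<sigma> x) s = p j"
    "(deriv ^^ j) (\<lambda>\<sigma>. param_deriv G 2 \<sigma> x) s = q j" if "flat (Suc j) m s" for j
  proof -
    have F: "times_diff j (\<lambda>\<sigma>. Im (F (\<zeta> \<sigma>))) I" for j by (rule smooth_curve(2)[OF holo_F])
    show "(deriv ^^ j) (\<lambda>\<sigma>. param_deriv G 1 \<sigma> x) s = p j"
      unfolding p_def by (rule unfolding_direction_jet[OF s that smooth_curve(2)[OF holo_H] G\<^sub>1])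
    have "(deriv ^^ j) (\<lambda>\<sigma>. param_deriv G 2 \<sigma> x) s = (deriv ^^ j) (\<lambda>\<sigma>. - Im (F (\<zeta> \<sigma>))) s"
      by (rule unfolding_direction_jet[OF s that times_diff_minus[OF open_I F] G\<^sub>2])
    then show "(deriv ^^ j) (\<lambda>\<sigma>. param_deriv G 2 \<sigma> x) s = q j"
      unfolding q_def using iterated_deriv_minus[OF open_I F s] by simp
  qed
  have flat2: "flat 2 m s"
    using flat_m[OF s, of 1] m0 jac0 by (simp add: flat_def numeral_2_eq_2)
  show "versal_at 2 G s x"
    unfolding versal_at_def
  proof
    fix w :: "nat \<Rightarrow> real"
    have nz: "p 1 * p 1 + q 1 * q 1 \<noteq> 0"
      using c_deriv_nonzero[OF s] by (auto simp: p_def q_def add_nonneg_eq_0_iff)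
    let ?a = "vector [w 1 * p 1 / (p 1 * p 1 + q 1 * q 1), w 1 * q 1 / (p 1 * p 1 + q 1 * q 1)] :: real^2"
    have "w 1 = ?a $ 1 * p 1 + ?a $ 2 * q 1"
      using nz by (simp add: add_divide_distrib[symmetric] distrib_left[symmetric] mult.assoc)
    then show "\<exists>a :: real^2. \<forall>j\<in>{1..<2}.
        w j = (\<Sum>i\<in>UNIV. a $ i * (deriv ^^ j) (\<lambda>\<sigma>. param_deriv G i \<sigma> x) s)"
      using jet[of 1] flat2 by (intro exI[of _ ?a]) (auto simp: sum_2 numeral_2_eq_2 less_Suc_eq)
  qed
  assume jac1: "deriv (\<lambda>\<sigma>. jac (\<zeta> \<sigma>)) s = 0" and jt: "jac_t (\<zeta> s) \<noteq> 0"
  have flat3: "flat 3 m s"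
    using flat_m[OF s, of 2] m0 jac0 jac1 by (simp add: flat_def numeral_2_eq_2 numeral_3_eq_3 less_Suc_eq)
  show "versal_at 3 G s x"
    unfolding versal_at_def
  proof
    fix w :: "nat \<Rightarrow> real"
    define d where "d = p 1 * q 2 - q 1 * p 2"
    have nz: "d \<noteq> 0"
      using c_curvature_nonzero[OF s m0 jac0 jac1 jt]
      by (simp add: d_def p_def q_def numeral_2_eq_2 algebra_simps)
    let ?a = "vector [(w 1 * q 2 - w 2 * q 1) / d, (p 1 * w 2 - p 2 * w 1) / d] :: real^2"
    have "(w 1 * q 2 - w 2 * q 1) * p 1 + (p 1 * w 2 - p 2 * w 1) * q 1 = w 1 * d"
        "(w 1 * q 2 - w 2 * q 1) * p 2 + (p 1 * w 2 - p 2 * w 1) * q 2 = w 2 * d"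
      unfolding d_def by algebra+
    then have "w 1 = ?a $ 1 * p 1 + ?a $ 2 * q 1" "w 2 = ?a $ 1 * p 2 + ?a $ 2 * q 2"
      using nz by (simp_all add: add_divide_distrib[symmetric])
    moreover have "{1..<3} = {1, 2 :: nat}" by auto
    ultimately show "\<exists>a :: real^2. \<forall>j\<in>{1..<3}.
        w j = (\<Sum>i\<in>UNIV. a $ i * (deriv ^^ j) (\<lambda>\<sigma>. param_deriv G i \<sigma> x) s)"
      using jet[of 1] jet[of 2] flat2 flat3 
      by (intro exI[of _ ?a]) (auto simp: sum_2 numeral_2_eq_2 numeral_3_eq_3)
  qed
qed

end

section \<open>Derivatives in the direction of t and of the parameters\<close>

context holomorphic_pair
begin

lemma vertical_has_derivative:
  assumes "\<Phi> holomorphic_on W" and "Complex s (r h) \<in> W" and "(r has_real_derivative r') (at h)"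
  shows "((\<lambda>h. Re (\<Phi> (Complex s (r h)))) has_real_derivative - (r' * Im (deriv \<Phi> (Complex s (r h))))) (at h)"
    and "((\<lambda>h. Im (\<Phi> (Complex s (r h)))) has_real_derivative r' * Re (deriv \<Phi> (Complex s (r h)))) (at h)"
proof -
  have \<Phi>: "(\<Phi> has_field_derivative deriv \<Phi> (Complex s (r h))) (at (Complex s (r h)))"
    using holomorphic_derivI[OF assms(1) open_W assms(2)] .
  have "((\<lambda>h. of_real s + \<i> * of_real (r h)) has_vector_derivative (\<i> * of_real r')) (at h)"
    using assms(3) by (auto intro!: derivative_eq_intros has_vector_derivative_of_real
        simp: has_real_derivative_iff_has_vector_derivative)
  then have "((\<lambda>h. Complex s (r h)) has_vector_derivative Complex 0 r') (at h)"
    by (simp add: Complex_eq)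
  from field_vector_diff_chain_at[OF this \<Phi>]
  have V: "((\<lambda>h. \<Phi> (Complex s (r h))) has_vector_derivative
      Complex 0 r' * deriv \<Phi> (Complex s (r h))) (at h)"
    by (simp add: o_def)
  show "((\<lambda>h. Re (\<Phi> (Complex s (r h)))) has_real_derivative - (r' * Im (deriv \<Phi> (Complex s (r h))))) (at h)"
    using has_field_derivative_Re[OF V] by simp
  show "((\<lambda>h. Im (\<Phi> (Complex s (r h)))) has_real_derivative r' * Re (deriv \<Phi> (Complex s (r h)))) (at h)"
    using has_field_derivative_Im[OF V] by simp
qed

lemma jac_vertical:
  assumes "Complex s r \<in> W"
  shows "((\<lambda>r. jac (Complex s r)) has_real_derivative jac_t (Complex s r)) (at r)"
  unfolding jac_def jac_t_def
  apply (rule DERIV_cong)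
   apply (rule vertical_has_derivative[where r = "\<lambda>r. r", OF _ assms DERIV_ident] derivative_eq_intros refl holo)+
  by (simp add: algebra_simps)

text \<open>The derivative of \<open>[x + h e - X, c] = 0\<close> with respect to \<open>h\<close> at \<open>h = 0\<close>, for fixed \<open>s\<close>.\<close>

lemma pencil_parameter_velocity:
  assumes "open N" and "0 \<in> N"
    and pencil: "\<And>h. h \<in> N \<Longrightarrow> (x\<^sub>1 + h * e\<^sub>1 - Re (F (Complex s (r h)))) * Im (H (Complex s (r h)))
      = (x\<^sub>2 + h * e\<^sub>2 - Re (H (Complex s (r h)))) * Im (F (Complex s (r h)))"
    and r': "(r has_real_derivative r') (at 0)" and z: "Complex s (r 0) \<in> W"
  shows "r' * (gt (Complex s (r 0)) + \<nu> x\<^sub>1 x\<^sub>2 (Complex s (r 0)))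
    = e\<^sub>1 * Im (H (Complex s (r 0))) - e\<^sub>2 * Im (F (Complex s (r 0)))"
proof -
  let ?p = "\<lambda>h. (x\<^sub>1 + h * e\<^sub>1 - Re (F (Complex s (r h)))) * Im (H (Complex s (r h)))
      - (x\<^sub>2 + h * e\<^sub>2 - Re (H (Complex s (r h)))) * Im (F (Complex s (r h)))"
  have "(?p has_real_derivative e\<^sub>1 * Im (H (Complex s (r 0))) - e\<^sub>2 * Im (F (Complex s (r 0)))
      - r' * (gt (Complex s (r 0)) + \<nu> x\<^sub>1 x\<^sub>2 (Complex s (r 0)))) (at 0)"
    unfolding gt_def \<nu>_def
    apply (rule DERIV_cong)
     apply (rule vertical_has_derivative[where r = r, OF _ z r'] derivative_eq_intros refl holo)+
    by (simp add: algebra_simps)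
  moreover have "(?p has_real_derivative 0) (at 0)"
    by (rule has_field_derivative_transform_within_open[OF DERIV_const assms(1,2), of 0])
      (use pencil in simp)
  ultimately show ?thesis using DERIV_unique by fastforce
qed

lemma continuous_gt: "continuous_on W gt"
  unfolding gt_def by (intro continuous_intros holomorphic_on_imp_continuous_on holo)

end

lemma has_vector_derivative_vector2:
  assumes "(a has_real_derivative a') (at u)" and "(b has_real_derivative b') (at u)"
  shows "((\<lambda>u. vector [a u, b u] :: real^2) has_vector_derivative vector [a', b']) (at u)"
proof -
  have v: "(vector [p, q] :: real^2) = p *\<^sub>R axis 1 1 + q *\<^sub>R axis 2 1" for p q
    by (simp add: vec_eq_iff forall_2 axis_def)
  show ?thesis unfolding v
    using assms by (auto intro!: derivative_eq_intros simp: has_vector_derivative_def has_field_derivative_def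
     algebra_simps)
qed

text \<open>A function with both partial derivatives, one of them continuous, is differentiable in both
  variables jointly, and then the chain rule applies.\<close>

lemma DERIV_along_graph:
  fixes g :: "real \<Rightarrow> real \<Rightarrow> real"
  assumes "open \<Omega>" and "(s, q s) \<in> \<Omega>"
    and g_s: "((\<lambda>\<sigma>. g \<sigma> (q s)) has_real_derivative d) (at s)"
    and g_t: "\<And>\<sigma> r. (\<sigma>, r) \<in> \<Omega> \<Longrightarrow> ((\<lambda>r. g \<sigma> r) has_real_derivative e (\<sigma>, r)) (at r)"
    and cont: "continuous_on \<Omega> e" and q: "(q has_real_derivative q') (at s)"
  shows "((\<lambda>\<sigma>. g \<sigma> (q \<sigma>)) has_real_derivative d + q' * e (s, q s)) (at s)"
proof -
  obtain P Q where PQ: "open P" "open Q" "(s, q s) \<in> P \<times> Q" "P \<times> Q \<subseteq> \<Omega>"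
    using open_prod_elim[OF assms(1,2)] by blast
  obtain \<epsilon> where \<epsilon>: "\<epsilon> > 0" "ball (q s) \<epsilon> \<subseteq> Q" using PQ by (auto simp: open_contains_ball)
  let ?Y = "ball (q s) \<epsilon>"
  have sub: "P \<times> ?Y \<subseteq> \<Omega>" using PQ \<epsilon> by auto
  have in_PY: "(s, q s) \<in> P \<times> ?Y" "open (P \<times> ?Y)" using PQ \<epsilon> by (auto intro: open_Times)
  have "((\<lambda>(\<sigma>, r). g \<sigma> r) has_derivative (\<lambda>(u, v). u * d + blinfun_apply (blinfun_scaleR_left (e (s, q s))) v))
      (at (s, q s) within P \<times> ?Y)"
  proof (rule has_derivative_partialsI)
    show "((\<lambda>\<sigma>. g \<sigma> (q s)) has_derivative (\<lambda>u. u * d)) (at s within P)"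
      using g_s by (simp add: has_field_derivative_def mult_commute_abs has_derivative_at_withinI)
    show "((\<lambda>r. g \<sigma> r) has_derivative blinfun_apply (blinfun_scaleR_left (e (\<sigma>, r)))) (at r within ?Y)"
      if "\<sigma> \<in> P" "r \<in> ?Y" for \<sigma> r
    proof -
      have "(\<sigma>, r) \<in> \<Omega>" using that sub by auto
      moreover have "blinfun_apply (blinfun_scaleR_left (e (\<sigma>, r))) = (*) (e (\<sigma>, r))"
        by (auto simp: fun_eq_iff)
      ultimately show ?thesis using g_t by (simp add: has_field_derivative_def has_derivative_at_withinI)
    qed
    have "continuous (at (s, q s)) e"
      using cont assms(1,2) by (simp add: continuous_on_eq_continuous_at)
    then have "continuous (at (s, q s)) (\<lambda>p. blinfun_scaleR_left (e p))"
      by (intro bounded_linear.continuous[OF bounded_linear_blinfun_scaleR_left])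
    then show "continuous (at (s, q s) within P \<times> ?Y) (\<lambda>(\<sigma>, r). blinfun_scaleR_left (e (\<sigma>, r)))"
      by (auto intro: continuous_at_imp_continuous_within simp: case_prod_unfold)
  qed (use \<epsilon> in auto)
  then have g': "((\<lambda>(\<sigma>, r). g \<sigma> r) has_derivative (\<lambda>(u, v). u * d + v * e (s, q s))) (at (s, q s))"
    using at_within_open[OF in_PY] by simp
  have "((\<lambda>\<sigma>. (\<sigma>, q \<sigma>)) has_derivative (\<lambda>h. (h, h * q'))) (at s)"
    using q by (auto intro!: derivative_eq_intros simp: has_field_derivative_def mult_commute_abs)
  from has_derivative_compose[OF this g']
  moreover have "(\<lambda>h. h * d + (h * q') * e (s, q s)) = (*) (d + q' * e (s, q s))"
    by (auto simp: algebra_simps)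
  ultimately show ?thesis by (simp add: has_field_derivative_def)
qed

section \<open>Classification of the singularities of the family\<close>

theorem theorem4p2:
  fixes \<Omega> :: "(real \<times> real) set"
    and A B C D g \<delta> :: "real \<Rightarrow> real \<Rightarrow> real"
    and X c :: "real \<Rightarrow> real \<Rightarrow> real^2"
    and s\<^sub>0 t\<^sub>0 :: real and x\<^sub>0 :: "real^2"
  assumes "open \<Omega>" and "connected \<Omega>" and "simply_connected \<Omega>"
    and "(\<lambda>z. Complex (A (Re z) (Im z)) (- D (Re z) (Im z))) holomorphic_on {z. (Re z, Im z) \<in> \<Omega>}"
    and "(\<lambda>z. Complex (B (Re z) (Im z)) (C (Re z) (Im z))) holomorphic_on {z. (Re z, Im z) \<in> \<Omega>}"
    and "X = (\<lambda>s t. vector [A s t, B s t])"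
    and "c = (\<lambda>s t. vector [- D s t, C s t])"
    and "\<delta> = (\<lambda>s t. bracket (ds X s t) (dt X s t))"
    and "\<And>s t. (s, t) \<in> \<Omega> \<Longrightarrow>
           ((\<lambda>\<sigma>. g \<sigma> t) has_real_derivative bracket (ds X s t) (c s t)) (at s)"
    and "\<And>s t. (s, t) \<in> \<Omega> \<Longrightarrow>
           ((\<lambda>r. g s r) has_real_derivative bracket (dt X s t) (c s t)) (at t)"
    and "\<And>s t. (s, t) \<in> \<Omega> \<Longrightarrow> \<delta> s t = 0 \<Longrightarrow> (ds \<delta> s t, dt \<delta> s t) \<noteq> (0, 0)"
    and "(s\<^sub>0, t\<^sub>0) \<in> \<Omega>" and "\<delta> s\<^sub>0 t\<^sub>0 = 0"
    and "dt \<delta> s\<^sub>0 t\<^sub>0 \<noteq> 0" and "dt X s\<^sub>0 t\<^sub>0 \<noteq> 0"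
    and "bracket (dt X s\<^sub>0 t\<^sub>0) (c s\<^sub>0 t\<^sub>0) \<noteq> 0"
    and "x\<^sub>0 = X s\<^sub>0 t\<^sub>0"
  shows
    "\<exists>I\<^sub>0 J\<^sub>0 U\<^sub>0. open I\<^sub>0 \<and> s\<^sub>0 \<in> I\<^sub>0 \<and> open J\<^sub>0 \<and> t\<^sub>0 \<in> J\<^sub>0 \<and> open U\<^sub>0 \<and> x\<^sub>0 \<in> U\<^sub>0 \<and>
      (\<forall>I J U (t :: real \<Rightarrow> real^2 \<Rightarrow> real) (\<tau> :: real \<Rightarrow> real) (\<alpha> :: real \<Rightarrow> real)
          (G :: real \<Rightarrow> real^2 \<Rightarrow> real).
        open I \<and> s\<^sub>0 \<in> I \<and> I \<subseteq> I\<^sub>0 \<and>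
        open J \<and> t\<^sub>0 \<in> J \<and> J \<subseteq> J\<^sub>0 \<and>
        open U \<and> x\<^sub>0 \<in> U \<and> U \<subseteq> U\<^sub>0 \<and>
        I \<times> J \<subseteq> \<Omega> \<and>
        smooth_on (\<lambda>(s, x). t s x) (I \<times> U) \<and>
        (\<forall>s\<in>I. \<forall>x\<in>U. t s x \<in> J) \<and>
        (\<forall>s\<in>I. \<forall>r\<in>J. \<forall>x\<in>U. bracket (x - X s r) (c s r) = 0 \<longleftrightarrow> r = t s x) \<and>
        (\<forall>s\<in>I. \<forall>r\<in>J. dt \<delta> s r \<noteq> 0 \<and> dt X s r \<noteq> 0) \<and>
        smooth_on \<tau> I \<and>
        {(s, r) \<in> \<Omega>. \<delta> s r = 0} \<inter> (I \<times> J) = {(s, \<tau> s) | s. s \<in> I} \<and>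
        (\<forall>s\<in>I. ds X s (\<tau> s) + \<alpha> s *\<^sub>R dt X s (\<tau> s) = 0) \<and>
        G = (\<lambda>s x. g s (t s x))
        \<longrightarrow>
        (\<forall>s\<in>I. \<forall>x\<in>U.
          \<comment> \<open>(1)\<close>
          (is_A_point 1 G s x \<longleftrightarrow> x = X s (t s x) \<and> \<delta> s (t s x) \<noteq> 0) \<and>
          \<comment> \<open>(2)\<close>
          (is_A_point 2 G s x \<longleftrightarrow>
             x = X s (t s x) \<and> \<delta> s (t s x) = 0 \<and> deriv (\<lambda>\<sigma>. \<delta> \<sigma> (t \<sigma> x)) s \<noteq> 0) \<and>
          (x = X s (t s x) \<and> \<delta> s (t s x) = 0 \<longrightarrow>
             (deriv (\<lambda>\<sigma>. \<delta> \<sigma> (t \<sigma> x)) s \<noteq> 0 \<longleftrightarrow> \<alpha> s \<noteq> deriv \<tau> s)) \<and>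
          (is_A_point 2 G s x \<longrightarrow> versal_at 2 G s x) \<and>
          \<comment> \<open>(3)\<close>
          (is_A_point 3 G s x \<longleftrightarrow>
             x = X s (t s x) \<and> \<delta> s (t s x) = 0 \<and> deriv (\<lambda>\<sigma>. \<delta> \<sigma> (t \<sigma> x)) s = 0 \<and>
             (deriv ^^ 2) (\<lambda>\<sigma>. \<delta> \<sigma> (t \<sigma> x)) s \<noteq> 0) \<and>
          (x = X s (t s x) \<and> \<delta> s (t s x) = 0 \<longrightarrow>
             (deriv (\<lambda>\<sigma>. \<delta> \<sigma> (t \<sigma> x)) s = 0 \<and> (deriv ^^ 2) (\<lambda>\<sigma>. \<delta> \<sigma> (t \<sigma> x)) s \<noteq> 0 \<longleftrightarrow>
              \<alpha> s = deriv \<tau> s \<and> deriv \<alpha> s \<noteq> (deriv ^^ 2) \<tau> s)) \<and>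
          (is_A_point 3 G s x \<longrightarrow> versal_at 3 G s x)))"
proof -
  define F where "F z = Complex (A (Re z) (Im z)) (- D (Re z) (Im z))" for z
  define H where "H z = Complex (B (Re z) (Im z)) (C (Re z) (Im z))" for z
  define W where "W = {z. (Re z, Im z) \<in> \<Omega>}"
  have in_W: "Complex s r \<in> W \<longleftrightarrow> (s, r) \<in> \<Omega>" for s r by (simp add: W_def)
  have "open ((\<lambda>z. (Re z, Im z)) -` \<Omega>)"
    by (intro open_vimage \<open>open \<Omega>\<close> continuous_intros)
  then have open_W: "open W" by (simp add: W_def vimage_def)
  interpret holomorphic_pair F H W
    using assms(4,5) open_W by unfold_locales (simp_all add: F_def[abs_def] H_def[abs_def] W_def)
  have X: "X = (\<lambda>s r. vector [Re (F (Complex s r)), Re (H (Complex s r))])"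
    and c: "c = (\<lambda>s r. vector [Im (F (Complex s r)), Im (H (Complex s r))])"
    by (simp_all add: F_def H_def assms(6,7))
  have ds_X: "ds X s r = vector [Re (deriv F (Complex s r)), Re (deriv H (Complex s r))]"
    and dt_X: "dt X s r = vector [- Im (deriv F (Complex s r)), - Im (deriv H (Complex s r))]"
    if "(s, r) \<in> \<Omega>" for s r
  proof -
    have z: "Complex s r \<in> W" using that in_W by simp
    show "ds X s r = vector [Re (deriv F (Complex s r)), Re (deriv H (Complex s r))]"
      unfolding ds_def X
      by (rule vector_derivative_at, rule has_vector_derivative_vector2)
        (use curve_has_derivative(1)[where r = "\<lambda>\<sigma>. r" and r' = 0 and s = s] z holo in auto)
    show "dt X s r = vector [- Im (deriv F (Complex s r)), - Im (deriv H (Complex s r))]"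
      unfolding dt_def X
      by (rule vector_derivative_at, rule has_vector_derivative_vector2)
        (use vertical_has_derivative(1)[where r = "\<lambda>r. r" and r' = 1 and s = s and h = r] z holo in auto)
  qed
  have gt: "bracket (dt X s r) (c s r) = gt (Complex s r)"
    and gs: "bracket (ds X s r) (c s r) = gs (Complex s r)"
    and \<delta>: "\<delta> s r = jac (Complex s r)" if "(s, r) \<in> \<Omega>" for s r
    using that
    by (simp_all add: assms(8) c bracket_components ds_X dt_X gt_def gs_def jac_def algebra_simps)
  have dt_\<delta>: "dt \<delta> s r = jac_t (Complex s r)" if sr: "(s, r) \<in> \<Omega>" for s r
  proof -
    obtain P Q where PQ: "open P" "open Q" "(s, r) \<in> P \<times> Q" "P \<times> Q \<subseteq> \<Omega>"
      using open_prod_elim[OF \<open>open \<Omega>\<close> sr] by blast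
    have "((\<lambda>r. \<delta> s r) has_real_derivative jac_t (Complex s r)) (at r)"
      by (rule has_field_derivative_transform_within_open[OF jac_vertical \<open>open Q\<close>])
        (use PQ that in_W \<delta> in auto)
    then show ?thesis
      unfolding dt_def by (simp add: vector_derivative_at has_real_derivative_iff_has_vector_derivative)
  qed
  \<comment> \<open>The product of the three quantities that must not vanish in \<open>pencil_curve\<close>; its nonvanishing is an
    open condition that holds at the base point and defines the neighbourhoods.\<close>
  define \<psi> where "\<psi> p = (let z = Complex (fst (fst p)) (snd (fst p)); x\<^sub>1 = snd p $ 1; x\<^sub>2 = snd p $ 2 in
      gt z * (gt z + \<nu> x\<^sub>1 x\<^sub>2 z) * (gt z * (gt z + \<nu> x\<^sub>1 x\<^sub>2 z) + gs z * (gs z - \<mu> x\<^sub>1 x\<^sub>2 z)))"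
    for p :: "(real \<times> real) \<times> (real^2)"
  have cont: "continuous_on (\<Omega> \<times> (UNIV :: (real^2) set)) (\<lambda>p. \<Phi> (Complex (fst (fst p)) (snd (fst p))))"
    if "\<Phi> holomorphic_on W" for \<Phi> :: "complex \<Rightarrow> complex"
    by (rule continuous_on_compose2[OF holomorphic_on_imp_continuous_on[OF that]])
      (auto simp: in_W intro!: continuous_intros)
  note cont = cont[OF holo_F] cont[OF holo_H] cont[OF holo(3)] cont[OF holo(4)]
  have "continuous_on (\<Omega> \<times> UNIV) \<psi>"
    unfolding \<psi>_def[abs_def] Let_def gt_def gs_def \<mu>_def \<nu>_def
    by (rule cont continuous_intros)+
  then have "open ((\<Omega> \<times> UNIV) \<inter> \<psi> -` (- {0}))"
    by (rule continuous_open_preimage) (auto intro: open_Times \<open>open \<Omega>\<close>)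
  moreover have "((s\<^sub>0, t\<^sub>0), x\<^sub>0) \<in> (\<Omega> \<times> UNIV) \<inter> \<psi> -` (- {0})"
  proof -
    have gt0: "gt (Complex s\<^sub>0 t\<^sub>0) \<noteq> 0" using assms(12,16) gt by simp
    have "\<mu> (x\<^sub>0 $ 1) (x\<^sub>0 $ 2) (Complex s\<^sub>0 t\<^sub>0) = 0" "\<nu> (x\<^sub>0 $ 1) (x\<^sub>0 $ 2) (Complex s\<^sub>0 t\<^sub>0) = 0"
      by (simp_all add: assms(17) X \<mu>_def \<nu>_def)
    then show ?thesis using gt0 assms(12) by (simp add: \<psi>_def Let_def sum_squares_eq_zero_iff)
  qed
  ultimately obtain S U\<^sub>0 where S: "open S" "open U\<^sub>0" "(s\<^sub>0, t\<^sub>0) \<in> S" "x\<^sub>0 \<in> U\<^sub>0"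
      and sub: "S \<times> U\<^sub>0 \<subseteq> (\<Omega> \<times> UNIV) \<inter> \<psi> -` (- {0})"
    by (rule open_prod_elim) auto
  obtain I\<^sub>0 J\<^sub>0 where IJ: "open I\<^sub>0" "open J\<^sub>0" "s\<^sub>0 \<in> I\<^sub>0" "t\<^sub>0 \<in> J\<^sub>0" "I\<^sub>0 \<times> J\<^sub>0 \<subseteq> S"
    by (rule open_prod_elim[OF S(1,3)]) auto
  have nz: "\<psi> ((s, r), x) \<noteq> 0" if "s \<in> I\<^sub>0" "r \<in> J\<^sub>0" "x \<in> U\<^sub>0" for s r x
    using that IJ(5) sub by blast
  show ?thesis
  proof (intro exI[of _ I\<^sub>0] exI[of _ J\<^sub>0] exI[of _ U\<^sub>0], (rule conjI, rule IJ S)+,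
      intro allI impI ballI, elim conjE, goal_cases)
    case (1 I J U t \<tau> \<alpha> G s x)
    have I: "open I" "I \<subseteq> I\<^sub>0" and J: "J \<subseteq> J\<^sub>0" and U: "open U" "U \<subseteq> U\<^sub>0" and IJ_\<Omega>: "I \<times> J \<subseteq> \<Omega>"
      and s: "s \<in> I" and x: "x \<in> U" by fact+
    have sm_t: "smooth_on (\<lambda>(s, x). t s x) (I \<times> U)" and t_J: "\<forall>s\<in>I. \<forall>x\<in>U. t s x \<in> J"
      and t_iff: "\<forall>s\<in>I. \<forall>r\<in>J. \<forall>x\<in>U. (bracket (x - X s r) (c s r) = 0) = (r = t s x)"
      and nondeg: "\<forall>s\<in>I. \<forall>r\<in>J. dt \<delta> s r \<noteq> 0 \<and> dt X s r \<noteq> 0"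
      and sm_\<tau>: "smooth_on \<tau> I"
      and sing: "{(s, r) \<in> \<Omega>. \<delta> s r = 0} \<inter> (I \<times> J) = {(s, \<tau> s) |s. s \<in> I}"
      and \<alpha>: "\<forall>s\<in>I. ds X s (\<tau> s) + \<alpha> s *\<^sub>R dt X s (\<tau> s) = 0"
      and G: "G = (\<lambda>s x. g s (t s x))" by fact+
    have \<Omega>: "(\<sigma>, t \<sigma> y) \<in> \<Omega>" if "\<sigma> \<in> I" "y \<in> U" for \<sigma> y
      using IJ_\<Omega> t_J that by auto
    have pencil: "(y $ 1 - Re (F (Complex \<sigma> (t \<sigma> y)))) * Im (H (Complex \<sigma> (t \<sigma> y)))
        = (y $ 2 - Re (H (Complex \<sigma> (t \<sigma> y)))) * Im (F (Complex \<sigma> (t \<sigma> y)))"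
      if "\<sigma> \<in> I" "y \<in> U" for \<sigma> y
    proof -
      have "bracket (y - X \<sigma> (t \<sigma> y)) (c \<sigma> (t \<sigma> y)) = 0" using t_iff t_J that by blast
      then show ?thesis by (simp add: bracket_components X c)
    qed
    have \<psi>_nz: "\<psi> ((\<sigma>, r), x) \<noteq> 0" if "\<sigma> \<in> I" "r \<in> J" for \<sigma> r
      using nz that I J U x by blast
    interpret curve: pencil_curve F H W I "\<lambda>\<sigma>. t \<sigma> x" "x $ 1" "x $ 2"
    proof
      show "times_diff k (\<lambda>\<sigma>. t \<sigma> x) I" for k
        using Ck_on_imp_times_diff[OF I(1), of "(0, x)" "(1, 0)" "I \<times> U" k "\<lambda>(s, x). t s x"] sm_t x
        by (simp add: smooth_on_def)
      show "Complex \<sigma> (t \<sigma> x) \<in> W" if "\<sigma> \<in> I" for \<sigma> using \<Omega> x that in_W by simp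
    qed (use I pencil x \<psi>_nz t_J in \<open>auto simp: \<psi>_def Let_def\<close>)
    have G': "((\<lambda>\<sigma>. G \<sigma> x) has_real_derivative
        gs (Complex \<sigma> (t \<sigma> x)) + deriv (\<lambda>\<sigma>. t \<sigma> x) \<sigma> * gt (Complex \<sigma> (t \<sigma> x))) (at \<sigma>)" if "\<sigma> \<in> I" for \<sigma>
    proof -
      have "continuous_on \<Omega> (\<lambda>p. gt (Complex (fst p) (snd p)))"
        by (rule continuous_on_compose2[OF continuous_gt])
          (auto simp: in_W intro!: continuous_intros)
      from DERIV_along_graph[where g = g, OF \<open>open \<Omega>\<close> \<Omega>[OF that x] _ _ this curve.t'[OF that]]
      show ?thesis using assms(9)[OF \<Omega>[OF that x]] gs[OF \<Omega>[OF that x]] assms(10) gt by (simp add: G)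
    qed
    have partials: "param_deriv G i \<sigma> x * (gt (Complex \<sigma> (t \<sigma> x)) + \<nu> (x $ 1) (x $ 2) (Complex \<sigma> (t \<sigma> x)))
        = ((axis i 1 :: real^2) $ 1 * Im (H (Complex \<sigma> (t \<sigma> x)))
          - (axis i 1 :: real^2) $ 2 * Im (F (Complex \<sigma> (t \<sigma> x)))) * gt (Complex \<sigma> (t \<sigma> x))"
      if "\<sigma> \<in> I" for i \<sigma>
    proof -
      let ?N = "{h. x + h *\<^sub>R axis i 1 \<in> U}" and ?r = "\<lambda>h. t \<sigma> (x + h *\<^sub>R axis i 1)"
      have "open ((\<lambda>h. x + h *\<^sub>R axis i 1) -` U)" by (intro open_vimage U continuous_intros)
      then have N: "open ?N" "0 \<in> ?N" using x by (simp_all add: vimage_def)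
      have "times_diff (Suc 0) ?r ?N"
        using Ck_on_imp_times_diff[OF N(1), of "(\<sigma>, x)" "(0, axis i 1)" "I \<times> U" "Suc 0" "\<lambda>(s, x). t s x"]
          sm_t that by (simp add: smooth_on_def del: Ck_on.simps times_diff.simps)
      then have r': "(?r has_real_derivative deriv ?r 0) (at 0)"
        using N(2) by (rule times_diff_has_derivative)
      have "((\<lambda>r. g \<sigma> r) has_real_derivative gt (Complex \<sigma> (t \<sigma> x))) (at (?r 0))"
        using assms(10)[OF \<Omega>[OF that x]] gt[OF \<Omega>[OF that x]] by simp
      from DERIV_chain2[OF this r'] have "param_deriv G i \<sigma> x = gt (Complex \<sigma> (t \<sigma> x)) * deriv ?r 0"
        unfolding param_deriv_def G by (rule DERIV_imp_deriv)
      moreover have "deriv ?r 0 * (gt (Complex \<sigma> (?r 0)) + \<nu> (x $ 1) (x $ 2) (Complex \<sigma> (?r 0)))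
          = (axis i 1 :: real^2) $ 1 * Im (H (Complex \<sigma> (?r 0))) - (axis i 1 :: real^2) $ 2 * Im (F (Complex \<sigma> (?r 0)))"
      proof (rule pencil_parameter_velocity[OF N _ r'])
        show "Complex \<sigma> (?r 0) \<in> W" using curve.in_W that by simp
      qed (use pencil that in fastforce)
      then have "deriv ?r 0 * (gt (Complex \<sigma> (t \<sigma> x)) + \<nu> (x $ 1) (x $ 2) (Complex \<sigma> (t \<sigma> x)))
          = (axis i 1 :: real^2) $ 1 * Im (H (Complex \<sigma> (t \<sigma> x)))
            - (axis i 1 :: real^2) $ 2 * Im (F (Complex \<sigma> (t \<sigma> x)))"
        by simp
      ultimately show ?thesis by algebra
    qed
    have on_X: "x = X s (t s x) \<longleftrightarrow> curve.m s = 0"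
      using curve.m_zero_iff[OF s] by (simp add: X vec_eq_iff forall_2)
    have \<delta>_jac: "(deriv ^^ j) (\<lambda>\<sigma>. \<delta> \<sigma> (t \<sigma> x)) s = (deriv ^^ j) (\<lambda>\<sigma>. jac (Complex \<sigma> (t \<sigma> x))) s" for j
      by (rule iterated_deriv_cong[OF I(1) _ s]) (simp add: \<delta> \<Omega> x)
    note \<delta>_jac012 = \<delta>_jac[of 0, simplified] \<delta>_jac[of 1, simplified] \<delta>_jac[of 2]
    note A = curve.A_point_iff[where G = G and x = x, OF G' s]
    have A1: "is_A_point 1 G s x \<longleftrightarrow> x = X s (t s x) \<and> \<delta> s (t s x) \<noteq> 0"
      using A[of 0] on_X \<delta>_jac012 by simp
    have A2: "is_A_point 2 G s x \<longleftrightarrow>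
        x = X s (t s x) \<and> \<delta> s (t s x) = 0 \<and> deriv (\<lambda>\<sigma>. \<delta> \<sigma> (t \<sigma> x)) s \<noteq> 0"
      using A[of 1] on_X \<delta>_jac012 by (simp add: numeral_2_eq_2 flat_Suc)
    have A3: "is_A_point 3 G s x \<longleftrightarrow>
        x = X s (t s x) \<and> \<delta> s (t s x) = 0 \<and> deriv (\<lambda>\<sigma>. \<delta> \<sigma> (t \<sigma> x)) s = 0 \<and>
        (deriv ^^ 2) (\<lambda>\<sigma>. \<delta> \<sigma> (t \<sigma> x)) s \<noteq> 0"
      using A[of 2] on_X \<delta>_jac012 by (simp add: numeral_2_eq_2 numeral_3_eq_3 flat_Suc)
    have jt: "jac_t (Complex s (t s x)) \<noteq> 0"
      using nondeg s x t_J dt_\<delta>[OF \<Omega>[OF s x]] by fastforce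
    have versal: "versal_at 2 G s x"
      and versal': "deriv (\<lambda>\<sigma>. \<delta> \<sigma> (t \<sigma> x)) s = 0 \<Longrightarrow> versal_at 3 G s x"
      if "x = X s (t s x)" "\<delta> s (t s x) = 0"
      using curve.versal_if_A_point[of G x s] partials[of _ 1] partials[of _ 2] s that on_X \<delta>_jac012 jt
      by (simp_all add: axis_def)
    have \<tau>: "(\<sigma>, \<tau> \<sigma>) \<in> \<Omega>" "\<tau> \<sigma> \<in> J" "\<delta> \<sigma> (\<tau> \<sigma>) = 0" if "\<sigma> \<in> I" for \<sigma>
    proof -
      have "(\<sigma>, \<tau> \<sigma>) \<in> {(s, r) \<in> \<Omega>. \<delta> s r = 0} \<inter> (I \<times> J)" unfolding sing using that by blast
      then show "(\<sigma>, \<tau> \<sigma>) \<in> \<Omega>" "\<tau> \<sigma> \<in> J" "\<delta> \<sigma> (\<tau> \<sigma>) = 0" by auto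
    qed
    have t_\<tau>: "t s x = \<tau> s" if "\<delta> s (t s x) = 0"
    proof -
      have "(s, t s x) \<in> {(s, r) \<in> \<Omega>. \<delta> s r = 0} \<inter> (I \<times> J)" using that \<Omega> s x t_J by auto
      then show ?thesis unfolding sing by auto
    qed
    have smooth_\<tau>: "times_diff k \<tau> I" for k
      using Ck_on_imp_times_diff[OF I(1), of 0 1 I k \<tau>] sm_\<tau> by (simp add: smooth_on_def)
    have gt_\<tau>: "gt (Complex \<sigma> (\<tau> \<sigma>)) \<noteq> 0" if "\<sigma> \<in> I" for \<sigma>
      using \<psi>_nz[OF that \<tau>(2)[OF that]] by (simp add: \<psi>_def Let_def)
    have gs_\<tau>: "gs (Complex \<sigma> (\<tau> \<sigma>)) + \<alpha> \<sigma> * gt (Complex \<sigma> (\<tau> \<sigma>)) = 0" if "\<sigma> \<in> I" for \<sigma>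
    proof -
      have "bracket (ds X \<sigma> (\<tau> \<sigma>) + \<alpha> \<sigma> *\<^sub>R dt X \<sigma> (\<tau> \<sigma>)) (c \<sigma> (\<tau> \<sigma>)) = 0"
        using \<alpha> that by (simp add: bracket_components)
      then show ?thesis
        unfolding gs[OF \<tau>(1)[OF that], symmetric] gt[OF \<tau>(1)[OF that], symmetric]
        by (simp add: bracket_components algebra_simps)
    qed
    have tangency: "deriv (\<lambda>\<sigma>. \<delta> \<sigma> (t \<sigma> x)) s \<noteq> 0 \<longleftrightarrow> \<alpha> s \<noteq> deriv \<tau> s"
      "deriv (\<lambda>\<sigma>. \<delta> \<sigma> (t \<sigma> x)) s = 0 \<and> (deriv ^^ 2) (\<lambda>\<sigma>. \<delta> \<sigma> (t \<sigma> x)) s \<noteq> 0 \<longleftrightarrow>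
        \<alpha> s = deriv \<tau> s \<and> deriv \<alpha> s \<noteq> (deriv ^^ 2) \<tau> s"
      if "x = X s (t s x)" "\<delta> s (t s x) = 0"
    proof -
      have "curve.m s = 0" using that on_X by simp
      note pre = smooth_\<tau> _ _ gt_\<tau> gs_\<tau> s this t_\<tau>[OF that(2)] jt
      have W: "Complex \<sigma> (\<tau> \<sigma>) \<in> W" "jac (Complex \<sigma> (\<tau> \<sigma>)) = 0" if "\<sigma> \<in> I" for \<sigma>
        using \<tau>[OF that] in_W \<delta> by auto
      show "deriv (\<lambda>\<sigma>. \<delta> \<sigma> (t \<sigma> x)) s \<noteq> 0 \<longleftrightarrow> \<alpha> s \<noteq> deriv \<tau> s"
        unfolding \<delta>_jac012 by (rule curve.jac_deriv_nonzero_iff[OF pre]) (use W in auto)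
      show "deriv (\<lambda>\<sigma>. \<delta> \<sigma> (t \<sigma> x)) s = 0 \<and> (deriv ^^ 2) (\<lambda>\<sigma>. \<delta> \<sigma> (t \<sigma> x)) s \<noteq> 0 \<longleftrightarrow>
          \<alpha> s = deriv \<tau> s \<and> deriv \<alpha> s \<noteq> (deriv ^^ 2) \<tau> s"
        unfolding \<delta>_jac012
        by (rule curve.jac_deriv2_nonzero_iff[OF pre]) (use W that \<delta>_jac012 in auto)
    qed
    show ?case
      using A1 A2 A3 versal versal' tangency by blast
  qed
qed

end
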